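(* Let $c_1,c_2\in\mathbb{R}$ be given constants. If $a\le1$, $\rho\in(-1,1)$ and $x\ge0$, then $$\lim_{u\to\infty}\mathbb{P}\left\{u^2\bigl(1-\tau_{sim}(u)\bigr)\le x\ \middle|\ \tau_{sim}(u)\le1\right\}=1-\exp\left(-\frac{q_{a,\rho}\,x}{2}\right),$$ where $$q_{a,\rho}=\frac{1-2a\rho+a^2}{1-\rho^2}\ \text{ if } a>\rho,\qquad q_{a,\rho}=1\ \text{ if } a\le\rho.$$
   Context: $B_1,B_2$ are two independent standard Brownian motions and $(W_1(t),W_2(t))_{t\ge0}$ has the same law as $(B_1(t),\ \rho B_1(t)+\sqrt{1-\rho^2}\,B_2(t))_{t\ge0}$. The simultaneous ruin time on $[0,1]$ is $$\tau_{sim}(u)=\inf\{t\in[0,1]:\ W_1(t)-c_1t>u,\ W_2(t)-c_2t>au\},$$ with the convention $\inf\emptyset=+\infty$. *)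

theory Defs
  imports "HOL-Probability.Probability"
begin

text \<open>
  A process is a function \<open>X t \<omega>\<close>, of which only the times \<open>t \<ge> 0\<close> matter. Its path is viewed as an
  element of the product space over the index set \<open>{0..}\<close>, with the product sigma-algebra.
\<close>

definition sample_path :: "(real \<Rightarrow> 'a \<Rightarrow> 'b) \<Rightarrow> 'a \<Rightarrow> real \<Rightarrow> 'b" where
  "sample_path X \<omega> = (\<lambda>t\<in>{0..}. X t \<omega>)"

definition path_space :: "(real \<Rightarrow> 'b::topological_space) measure" where
  "path_space = (\<Pi>\<^sub>M t\<in>{0..}. borel)"

definition process_law ::
  "'a measure \<Rightarrow> (real \<Rightarrow> 'a \<Rightarrow> 'b::topological_space) \<Rightarrow> (real \<Rightarrow> 'b) measure" where
  "process_law M X = distr M path_space (sample_path X)"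

definition continuous_process ::
  "'a measure \<Rightarrow> (real \<Rightarrow> 'a \<Rightarrow> 'b::topological_space) \<Rightarrow> bool" where
  "continuous_process M X \<longleftrightarrow>
     (\<forall>t\<ge>0. X t \<in> borel_measurable M) \<and> (AE \<omega> in M. continuous_on {0..} (\<lambda>t. X t \<omega>))"

definition standard_brownian_motion :: "'a measure \<Rightarrow> (real \<Rightarrow> 'a \<Rightarrow> real) \<Rightarrow> bool" where
  "standard_brownian_motion M B \<longleftrightarrow>
     prob_space M \<and>
     continuous_process M B \<and>
     (AE \<omega> in M. B 0 \<omega> = 0) \<and>
     (\<forall>(n::nat) (t::nat \<Rightarrow> real). 0 \<le> t 0 \<and> (\<forall>i<n. t i \<le> t (Suc i)) \<longrightarrow>
        prob_space.indep_vars M (\<lambda>_. borel) (\<lambda>i \<omega>. B (t (Suc i)) \<omega> - B (t i) \<omega>) {..<n}) \<and>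
     (\<forall>s t. 0 \<le> s \<and> s < t \<longrightarrow>
        distributed M lborel (\<lambda>\<omega>. B t \<omega> - B s \<omega>) (normal_density 0 (sqrt (t - s))))"

definition independent_processes ::
  "'a measure \<Rightarrow> (real \<Rightarrow> 'a \<Rightarrow> real) \<Rightarrow> (real \<Rightarrow> 'a \<Rightarrow> real) \<Rightarrow> bool" where
  "independent_processes M X Y \<longleftrightarrow>
     prob_space.indep_var M path_space (sample_path X) path_space (sample_path Y)"

text \<open>
  The infimum is taken in the extended reals, where the infimum of the empty set is \<open>\<infinity>\<close>.
\<close>

definition tau_sim ::
  "(real \<Rightarrow> 'a \<Rightarrow> real) \<Rightarrow> (real \<Rightarrow> 'a \<Rightarrow> real) \<Rightarrow> real \<Rightarrow> real \<Rightarrow> real \<Rightarrow> real \<Rightarrow> 'a \<Rightarrow> ereal" where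
  "tau_sim W1 W2 c1 c2 a u \<omega> =
     Inf (ereal ` {t \<in> {0..1}. W1 t \<omega> - c1 * t > u \<and> W2 t \<omega> - c2 * t > a * u})"

definition q_const :: "real \<Rightarrow> real \<Rightarrow> real" where
  "q_const a \<rho> = (if a > \<rho> then (1 - 2 * a * \<rho> + a\<^sup>2) / (1 - \<rho>\<^sup>2) else 1)"

text \<open>
  Paths are only required to be continuous almost surely, so events about \<open>tau_sim\<close> need not lie in
  the given sigma-algebra, but they are measurable with respect to its completion. Probabilities of
  such events should therefore be taken in \<open>completion N\<close>, which agrees with \<open>N\<close> on all sets
  measurable for \<open>N\<close>.
\<close>

end

theory Submission imports Defs begin

text \<open>
  Let \<open>\<delta> = x / u\<^sup>2\<close>. Up to null sets, \<open>u\<^sup>2 (1 - \<tau>) > x\<close> means ruin before \<open>1 - \<delta>\<close>, so one has to compare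
  ruin during \<open>[1/2 - \<delta>, 1 - \<delta>]\<close> with ruin during \<open>[1/2, 1]\<close>; ruin before \<open>1/2\<close> is exponentially less likely.
  By the Markov property both probabilities integrate the same function of the starting position, namely
  the probability that a planar Brownian motion with drift enters a fixed set within time \<open>1/2\<close>, and only the Gaussian law of
  the starting position differs. The density of one law with respect to the other
  is bounded and close to \<open>exp (- 2 \<delta> |w|\<^sup>2)\<close>. Given ruin, the position at time \<open>1/2\<close> concentrates, by exponential Chernoff
  bounds, around half of the point of the ruin set nearest to the origin, where \<open>|w|\<^sup>2 \<approx> q u\<^sup>2 / 4\<close>;
  hence the ratio tends to \<open>exp (- q x / 2)\<close>, and no exact asymptotics of either probability is needed.
\<close>

text \<open>The obstacle is continuous time: a Markov property for events about all times would need
  path laws started at arbitrary points. It is used only for walks on finite grids, where it is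
  Fubini on a product measure. Every bound is uniform in the step, so for fixed \<open>u\<close> it
  passes to dyadic grids by continuity from below, and to all times by continuity of paths. Both
  windows have length 1/2, so one and the same walk serves for both; they start at positive times,
  so that the two starting laws have Gaussian densities. All errors are measured against ruin at
  time 1 alone, which has probability at least C exp(-q u^2/2 - K u). Ruin up to time 1/2 costs
  exp(-3 q u^2/4 + O(u)), and leaving the bulk costs an extra exp(-3 \<eta>^2 u^2/4 + O(u)). A
  quadratic gain beats a linear loss, which is why crude constants (absolute values of drifts, a
  unit square near the corner) suffice.\<close>

section \<open>Hitting probabilities of random walks\<close>

text \<open>Probability that the walk from \<open>w\<close> with increment law \<mu> visits
  \<open>U\<close> within \<open>k\<close> steps, the start included. The backward recursion builds
  the Markov property into the definition.\<close>

primrec hit :: "'b::{plus} set \<Rightarrow> 'b measure \<Rightarrow> nat \<Rightarrow> 'b \<Rightarrow> ennreal" where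
  "hit U \<mu> 0 w = indicator U w"
| "hit U \<mu> (Suc k) w = (if w \<in> U then 1 else \<integral>\<^sup>+z. hit U \<mu> k (w + z) \<partial>\<mu>)"

lemma hit_measurable:
  fixes U :: "'b::{second_countable_topology, topological_monoid_add} set"
  assumes [measurable]: "U \<in> sets borel" and s[measurable_cong]: "sets \<mu> = sets borel" and "sigma_finite_measure \<mu>"
  shows "hit U \<mu> k \<in> borel_measurable borel"
proof (induction k)
  case 0
  have "hit U \<mu> 0 = indicator U" by (simp add: fun_eq_iff)
  then show ?case by simp
next
  case (Suc k)
  interpret sigma_finite_measure \<mu> by fact
  note [measurable] = Suc
  show ?case by (subst hit.simps(2)[abs_def]) measurable
qed

text \<open>A maximal inequality without stopping times: along the walk the expectation of
  \<open>F\<close> grows by at most \<open>c\<close> per step, and induction follows the recursion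
  of \<open>hit\<close>. Walks that hit early are charged the full \<open>c ^ k\<close>, whence
  \<open>1 \<le> c\<close>.\<close>

lemma hit_le_supermartingale:
  fixes F :: "'b::{second_countable_topology, topological_monoid_add} \<Rightarrow> ennreal"
  assumes F: "\<And>w. w \<in> U \<Longrightarrow> 1 \<le> F w" and c: "1 \<le> c"
    and step: "\<And>w. (\<integral>\<^sup>+z. F (w + z) \<partial>\<mu>) \<le> c * F w"
    and [measurable]: "F \<in> borel_measurable borel" and [measurable_cong]: "sets \<mu> = sets borel"
  shows "hit U \<mu> k w \<le> c ^ k * F w"
proof (induction k arbitrary: w)
  case 0
  then show ?case using F by (auto simp: indicator_def)
next
  case (Suc k)
  show ?case
  proof (cases "w \<in> U")
    case True
    have "1 * 1 \<le> c ^ Suc k * F w"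
      using F[OF True] one_le_power[OF c, of "Suc k"] by (intro mult_mono) auto
    then show ?thesis using True by simp
  next
    case False
    have "(\<integral>\<^sup>+z. hit U \<mu> k (w + z) \<partial>\<mu>) \<le> (\<integral>\<^sup>+z. c ^ k * F (w + z) \<partial>\<mu>)"
      by (intro nn_integral_mono Suc)
    also have "\<dots> = c ^ k * (\<integral>\<^sup>+z. F (w + z) \<partial>\<mu>)"
      by (subst nn_integral_cmult) auto
    also have "\<dots> \<le> c ^ k * (c * F w)"
      by (intro mult_left_mono step) simp
    finally show ?thesis using False by (simp add: ac_simps)
  qed
qed

lemma measurable_walk:
  fixes m :: "nat \<Rightarrow> 'b::{second_countable_topology, topological_comm_monoid_add} measure"
  assumes s: "\<And>i. sets (m i) = sets borel" and "j \<le> l"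
  shows "(\<lambda>x. \<Sum>i<j. x i) \<in> borel_measurable (PiM {..<l} m)"
proof (intro borel_measurable_sum)
  fix i assume "i \<in> {..<j}"
  then have "i \<in> {..<l}" using assms by simp
  from measurable_component_singleton[OF this, of m]
  show "(\<lambda>x. x i) \<in> borel_measurable (PiM {..<l} m)"
    by (simp add: measurable_cong_sets[OF refl s])
qed

lemma measurable_walk_hit:
  fixes U :: "'b::{second_countable_topology, topological_comm_monoid_add} set" and k l :: nat
  assumes U: "U \<in> sets borel" and s: "\<And>i. sets (m i) = sets borel" and k: "k \<le> l"
  shows "Measurable.pred (PiM {..<l} m) (\<lambda>x. \<exists>j\<in>{1..k}. (\<Sum>i<j. x i) \<in> U)"
proof (intro pred_intros_finite)
  fix j assume "j \<in> {1..k}"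
  then have "j \<le> l" using k by simp
  from measurable_sets[OF measurable_walk[OF s this] U]
  show "Measurable.pred (PiM {..<l} m) (\<lambda>x. (\<Sum>i<j. x i) \<in> U)"
    by (simp add: pred_def vimage_def Int_def conj_commute)
qed simp

text \<open>Fubini, one coordinate at a time: integrating out the last increment trades a coordinate
  of the product space for a step of the recursion, so \<open>n + k\<close> is invariant and
  \<open>n\<close> has to vary in the induction. Coordinate 0 is the random starting point; the
  empty sum is never tested.\<close>

lemma hit_eq_walk_integral:
  fixes U :: "'b::{second_countable_topology, topological_comm_monoid_add} set"
  assumes [measurable]: "U \<in> sets borel"
    and s: "sets \<mu>0 = sets borel" "sets \<mu> = sets borel"
    and "prob_space \<mu>0" "prob_space \<mu>"
  shows "(\<integral>\<^sup>+x. (if \<exists>j\<in>{1..k}. (\<Sum>i<j. x i) \<in> U then 1 else hit U \<mu> n (\<Sum>i<Suc k. x i))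
            \<partial>(\<Pi>\<^sub>M i\<in>{..<Suc k}. if i = 0 then \<mu>0 else \<mu>)) = (\<integral>\<^sup>+w. hit U \<mu> (n + k) w \<partial>\<mu>0)"
proof (induction k arbitrary: n)
  case 0
  let ?m = "\<lambda>i::nat. if i = 0 then \<mu>0 else \<mu>"
  interpret M0: prob_space \<mu>0 by fact
  interpret M1: prob_space \<mu> by fact
  interpret product_sigma_finite ?m
    by (simp add: product_sigma_finite_def M0.sigma_finite_measure_axioms M1.sigma_finite_measure_axioms)
  have m: "hit U \<mu> n \<in> borel_measurable \<mu>0"
    using hit_measurable[OF assms(1,3)] M1.sigma_finite_measure_axioms
    by (simp add: measurable_cong_sets[OF s(1) refl])
  show ?case
    using product_nn_integral_singleton[of "hit U \<mu> n" 0] m by (simp add: lessThan_Suc)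
next
  case (Suc k)
  let ?m = "\<lambda>i::nat. if i = 0 then \<mu>0 else \<mu>"
  interpret M0: prob_space \<mu>0 by fact
  interpret M1: prob_space \<mu> by fact
  interpret product_sigma_finite ?m
    by (simp add: product_sigma_finite_def M0.sigma_finite_measure_axioms M1.sigma_finite_measure_axioms)
  have [measurable]: "hit U \<mu> n \<in> borel_measurable borel" for n
    using hit_measurable[OF assms(1,3)] M1.sigma_finite_measure_axioms by simp
  have sm: "\<And>i. sets (?m i) = sets borel" using s by simp
  let ?f = "\<lambda>k n x. (if \<exists>j\<in>{1..k}. (\<Sum>i<j. x i) \<in> U then 1 else hit U \<mu> n (\<Sum>i<Suc k. x i))"
  have fm: "?f k n \<in> borel_measurable (PiM {..<Suc k} ?m)" for k n
  proof -
    have "k \<le> Suc k" by simp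
    from measurable_walk_hit[OF assms(1) sm this] measurable_walk[OF sm order_refl, of "Suc k"]
    have [measurable]: "Measurable.pred (PiM {..<Suc k} ?m) (\<lambda>x. \<exists>j\<in>{1..k}. (\<Sum>i<j. x i) \<in> U)"
      "(\<lambda>x. \<Sum>i<Suc k. x i) \<in> borel_measurable (PiM {..<Suc k} ?m)" .
    show ?thesis by measurable
  qed
  have ins: "{..<Suc (Suc k)} = insert (Suc k) {..<Suc k}" by auto
  have upd: "(\<Sum>i<j. (x(Suc k := y)) i) = (\<Sum>i<j. x i)" if "j \<le> Suc k" for j and x :: "nat \<Rightarrow> 'b" and y
    using that by (intro sum.cong) auto
  \<comment> \<open>All tested sums have at most \<open>Suc k\<close> terms, so the new coordinate
    enters only the argument of \<open>hit\<close>. After a hit the integrand is 1 and the measure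
    has mass 1; otherwise this is one unfolding of \<open>hit U \<mu> (Suc n)\<close>.\<close>
  have inner: "(\<integral>\<^sup>+y. ?f (Suc k) n (x(Suc k := y)) \<partial>?m (Suc k)) = ?f k (Suc n) x" for x
  proof -
    have s': "(\<Sum>i<Suc (Suc k). (x(Suc k := y)) i) = (\<Sum>i<Suc k. x i) + y" for y
      using upd[of "Suc k" x y] by (simp only: sum.lessThan_Suc) simp
    have e: "(\<exists>j\<in>{1..Suc k}. (\<Sum>i<j. (x(Suc k := y)) i) \<in> U) \<longleftrightarrow>
        (\<exists>j\<in>{1..k}. (\<Sum>i<j. x i) \<in> U) \<or> (\<Sum>i<Suc k. x i) \<in> U" (is "?L \<longleftrightarrow> ?R") for y
    proof -
      have "?L \<longleftrightarrow> (\<exists>j\<in>{1..Suc k}. (\<Sum>i<j. x i) \<in> U)"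
        using upd[of _ x y] by (intro bex_cong) auto
      also have "\<dots> \<longleftrightarrow> ?R"
        by (simp add: atLeastAtMostSuc_conv del: sum.lessThan_Suc) blast
      finally show ?thesis .
    qed
    show ?thesis
      unfolding s' e by (auto simp: M1.emeasure_space_1)
  qed
  have fi: "finite {..<Suc k}" "Suc k \<notin> {..<Suc k}" by auto
  have "integral\<^sup>N (PiM {..<Suc (Suc k)} ?m) (?f (Suc k) n) =
      (\<integral>\<^sup>+x. (\<integral>\<^sup>+y. ?f (Suc k) n (x(Suc k := y)) \<partial>?m (Suc k)) \<partial>PiM {..<Suc k} ?m)"
    using product_nn_integral_insert[OF fi, of "?f (Suc k) n"] fm[of "Suc k" n]
    by (simp only: ins[symmetric])
  also have "\<dots> = integral\<^sup>N (PiM {..<Suc k} ?m) (?f k (Suc n))"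
    by (simp only: inner)
  also have "\<dots> = integral\<^sup>N \<mu>0 (hit U \<mu> (n + Suc k))"
    using Suc[of "Suc n"] by (simp only: add_Suc add_Suc_right)
  finally show ?case .
qed

text \<open>The case \<open>n = 0\<close> of the preceding identity: \<open>hit U \<mu> 0\<close> is
  an indicator and supplies the missing test at \<open>j = Suc k\<close>.\<close>

lemma walk_hit_probability:
  fixes U :: "'b::{second_countable_topology, topological_comm_monoid_add} set"
  assumes [measurable]: "U \<in> sets borel"
    and s: "sets \<mu>0 = sets borel" "sets \<mu> = sets borel"
    and "prob_space \<mu>0" "prob_space \<mu>"
  shows "(\<integral>\<^sup>+x. indicator {x. \<exists>j\<in>{1..Suc k}. (\<Sum>i<j. x i) \<in> U} x
            \<partial>(\<Pi>\<^sub>M i\<in>{..<Suc k}. if i = 0 then \<mu>0 else \<mu>)) = (\<integral>\<^sup>+w. hit U \<mu> k w \<partial>\<mu>0)"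
proof -
  have "{1..Suc k} = insert (Suc k) {1..k}" by auto
  then have "indicator {x. \<exists>j\<in>{1..Suc k}. (\<Sum>i<j. x i) \<in> U} x =
     (if \<exists>j\<in>{1..k}. (\<Sum>i<j. x i) \<in> U then 1 else hit U \<mu> 0 (\<Sum>i<Suc k. x i))" for x :: "nat \<Rightarrow> 'b"
    by (auto simp: indicator_def simp del: sum.lessThan_Suc)
  then show ?thesis
    using hit_eq_walk_integral[OF assms, of k 0] by simp
qed

section \<open>The random walk of a Brownian motion on a grid\<close>

text \<open>Law at time \<open>t\<close> of a Brownian motion minus the drift \<open>v * t\<close>,
  hence the negative mean. Putting the drift into the law keeps the target set independent of
  time.\<close>

definition gauss :: "real \<Rightarrow> real \<Rightarrow> real measure" where
  "gauss v t = density lborel (normal_density (- (v * t)) (sqrt t))"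

definition gauss2 :: "real \<Rightarrow> real \<Rightarrow> real \<Rightarrow> (real \<times> real) measure" where
  "gauss2 v1 v2 t = gauss v1 t \<Otimes>\<^sub>M gauss v2 t"

lemma sets_gauss[measurable_cong, simp]: "sets (gauss v t) = sets borel"
  by (simp add: gauss_def)

lemma sets_gauss2[measurable_cong, simp]: "sets (gauss2 v1 v2 t) = sets borel"
proof -
  have "sets (gauss2 v1 v2 t) = sets (borel \<Otimes>\<^sub>M borel)"
    unfolding gauss2_def by (intro sets_pair_measure_cong) auto
  then show ?thesis by (simp only: borel_prod)
qed

lemma prob_space_gauss: "0 < t \<Longrightarrow> prob_space (gauss v t)"
  unfolding gauss_def by (intro prob_space_normal_density) simp

lemma prob_space_gauss2: "0 < t \<Longrightarrow> prob_space (gauss2 v1 v2 t)"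
  unfolding gauss2_def by (intro prob_space_pair prob_space_gauss)

text \<open>On rectangles the probability splits between the two families by \<open>XY\<close>, and
  inside each family by \<open>X\<close> and \<open>Y\<close>; rectangles are an intersection-stable
  generator. \<open>XY\<close> concerns whole vectors, since independence of each \<open>X i\<close>
  from \<open>Y i\<close> would be too weak.\<close>

lemma (in prob_space) indep_vars_pairI:
  assumes I: "finite I" "I \<noteq> {}"
    and X: "indep_vars S X I" and Y: "indep_vars T Y I"
    and XY: "indep_var (PiM I S) (\<lambda>\<omega>. \<lambda>i\<in>I. X i \<omega>) (PiM I T) (\<lambda>\<omega>. \<lambda>i\<in>I. Y i \<omega>)"
  shows "indep_vars (\<lambda>i. S i \<Otimes>\<^sub>M T i) (\<lambda>i \<omega>. (X i \<omega>, Y i \<omega>)) I"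
proof -
  have rv[measurable]: "random_variable (S i) (X i)" "random_variable (T i) (Y i)" if "i \<in> I" for i
    using X Y that by (auto simp: indep_vars_def)
  let ?E = "\<lambda>i. {a \<times> b | a b. a \<in> sets (S i) \<and> b \<in> sets (T i)}"
  have "prob (\<Inter>j\<in>I. (\<lambda>\<omega>. (X j \<omega>, Y j \<omega>)) -` A j \<inter> space M) =
        (\<Prod>j\<in>I. prob ((\<lambda>\<omega>. (X j \<omega>, Y j \<omega>)) -` A j \<inter> space M))" if "A \<in> Pi I ?E" for A
  proof -
    have "\<forall>j\<in>I. \<exists>a b. A j = a \<times> b \<and> a \<in> sets (S j) \<and> b \<in> sets (T j)"
      using that by (auto simp: Pi_iff)
    then obtain a b where ab: "\<And>j. j \<in> I \<Longrightarrow> A j = a j \<times> b j"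
      and am: "\<And>j. j \<in> I \<Longrightarrow> a j \<in> sets (S j)" and bm: "\<And>j. j \<in> I \<Longrightarrow> b j \<in> sets (T j)"
      by metis
    have two: "prob ((\<lambda>\<omega>. (X j \<omega>, Y j \<omega>)) -` A j \<inter> space M) =
        prob (X j -` a j \<inter> space M) * prob (Y j -` b j \<inter> space M)" if j: "j \<in> I" for j
    proof -
      have "indep_var (S j) ((\<lambda>f. f j) \<circ> (\<lambda>\<omega>. \<lambda>i\<in>I. X i \<omega>)) (T j) ((\<lambda>f. f j) \<circ> (\<lambda>\<omega>. \<lambda>i\<in>I. Y i \<omega>))"
        by (rule indep_var_compose[OF XY]) (auto intro: measurable_component_singleton j)
      then have "indep_var (S j) (X j) (T j) (Y j)"
        using j by (simp add: comp_def)
      from indep_varD[OF this am[OF j] bm[OF j]] show ?thesis by (simp add: ab[OF j])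
    qed
    have "(\<Inter>j\<in>I. (\<lambda>\<omega>. (X j \<omega>, Y j \<omega>)) -` A j \<inter> space M) =
       (\<lambda>\<omega>. (\<lambda>i\<in>I. X i \<omega>, \<lambda>i\<in>I. Y i \<omega>)) -` (PiE I a \<times> PiE I b) \<inter> space M"
      using I ab by (auto simp: PiE_iff)
    also have "prob \<dots> = prob ((\<lambda>\<omega>. \<lambda>i\<in>I. X i \<omega>) -` PiE I a \<inter> space M) *
        prob ((\<lambda>\<omega>. \<lambda>i\<in>I. Y i \<omega>) -` PiE I b \<inter> space M)"
      using I am bm by (intro indep_varD[OF XY] sets_PiM_I_finite) auto
    also have "(\<lambda>\<omega>. \<lambda>i\<in>I. X i \<omega>) -` PiE I a \<inter> space M = (\<Inter>j\<in>I. X j -` a j \<inter> space M)"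
      using I by (auto simp: PiE_iff)
    also have "(\<lambda>\<omega>. \<lambda>i\<in>I. Y i \<omega>) -` PiE I b \<inter> space M = (\<Inter>j\<in>I. Y j -` b j \<inter> space M)"
      using I by (auto simp: PiE_iff)
    also have "prob (\<Inter>j\<in>I. X j -` a j \<inter> space M) = (\<Prod>j\<in>I. prob (X j -` a j \<inter> space M))"
      using I am by (intro indep_varsD[OF X]) auto
    also have "prob (\<Inter>j\<in>I. Y j -` b j \<inter> space M) = (\<Prod>j\<in>I. prob (Y j -` b j \<inter> space M))"
      using I bm by (intro indep_varsD[OF Y]) auto
    finally show ?thesis by (simp add: two prod.distrib)
  qed
  then show ?thesis
    by (subst indep_vars_finite[OF I(2,1), where E = ?E])
       (auto simp: sets_pair_measure space_pair_measure intro!: Int_stable_pair_measure_generator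
             dest: sets.sets_into_space)
qed

lemma (in prob_space) gauss_increment:
  assumes B: "standard_brownian_motion M B" and "0 \<le> s" "s < t"
  shows "distr M borel (\<lambda>\<omega>. (B t \<omega> - v * t) - (B s \<omega> - v * s)) = gauss v (t - s)"
proof -
  have "distributed M lborel (\<lambda>\<omega>. B t \<omega> - B s \<omega>) (normal_density 0 (sqrt (t - s)))"
    using assms unfolding standard_brownian_motion_def by blast
  then have "distributed M lborel (\<lambda>\<omega>. - (v * (t - s)) + 1 * (B t \<omega> - B s \<omega>))
      (normal_density (- (v * (t - s)) + 1 * 0) (\<bar>1\<bar> * sqrt (t - s)))"
    by (rule normal_density_affine) (use assms in auto)
  moreover have "- (v * (t - s)) + 1 * (B t \<omega> - B s \<omega>) = (B t \<omega> - v * t) - (B s \<omega> - v * s)" for \<omega>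
    by (simp add: right_diff_distrib)
  ultimately have "distributed M lborel (\<lambda>\<omega>. (B t \<omega> - v * t) - (B s \<omega> - v * s))
      (normal_density (- (v * (t - s))) (sqrt (t - s)))" by (simp only: abs_one mult_1 mult_zero_right add_0_right)
  then have "distr M lborel (\<lambda>\<omega>. (B t \<omega> - v * t) - (B s \<omega> - v * s)) = gauss v (t - s)"
    unfolding gauss_def by (rule distributed_distr_eq_density)
  then show ?thesis
    by (simp cong: distr_cong)
qed

lemma (in prob_space) indep_vars_drifted_increments:
  assumes B: "standard_brownian_motion M B" and t: "0 \<le> t 0" "\<And>i. t i \<le> t (Suc i)"
  shows "indep_vars (\<lambda>_. borel) (\<lambda>i \<omega>. (B (t (Suc i)) \<omega> - v * t (Suc i)) - (B (t i) \<omega> - v * t i)) {..<n}"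
proof -
  have "indep_vars (\<lambda>_. borel) (\<lambda>i \<omega>. B (t (Suc i)) \<omega> - B (t i) \<omega>) {..<n}"
    using B t unfolding standard_brownian_motion_def by blast
  from indep_vars_compose2[OF this, of "\<lambda>i x. x - (v * t (Suc i) - v * t i)" "\<lambda>_. borel"]
  show ?thesis by (simp add: algebra_simps)
qed

text \<open>The planar increments are independent with known Gaussian laws, so their joint law is
  the product measure of \<open>walk_hit_probability\<close>. The increment from time 0 to
  \<open>t0\<close> plays the role of the random start.\<close>

lemma brownian_grid_hit_probability:
  assumes B1: "standard_brownian_motion M B1" and B2: "standard_brownian_motion M B2"
    and ind: "independent_processes M B1 B2"
    and t0: "0 < t0" and h: "0 < h" and U[measurable]: "U \<in> sets borel"
  shows "emeasure M {\<omega> \<in> space M. \<exists>j\<le>k. (B1 (t0 + real j * h) \<omega> - v1 * (t0 + real j * h),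
             B2 (t0 + real j * h) \<omega> - v2 * (t0 + real j * h)) \<in> U}
       = (\<integral>\<^sup>+w. hit U (gauss2 v1 v2 h) k w \<partial>gauss2 v1 v2 t0)" (is "emeasure M ?H = _")
proof -
  interpret prob_space M using B1 by (simp add: standard_brownian_motion_def)
  have [measurable]: "B1 s \<in> borel_measurable M" "B2 s \<in> borel_measurable M" if "0 \<le> s" for s
    using B1 B2 that by (auto simp: standard_brownian_motion_def continuous_process_def)
  \<comment> \<open>Index 0 is time 0, so the first increment reaches \<open>t0\<close>, and
    \<open>t (Suc i)\<close> is grid time number \<open>i\<close>. This shift turns
    \<open>j \<in> {1..Suc k}\<close> into \<open>j \<le> k\<close>.\<close>
  define t where "t i = (if i = 0 then 0 else t0 + real (i - 1) * h)" for i :: nat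
  have t_0: "t 0 = 0" and t_Suc: "t (Suc i) = t0 + real i * h" for i
    by (auto simp: t_def)
  have t_nonneg: "0 \<le> t i" for i using t0 h by (auto simp: t_def)
  have t_less: "t i < t (Suc i)" for i
    using t0 h by (cases i) (auto simp: t_def algebra_simps)
  define X where "X B v i \<omega> = (B (t (Suc i)) \<omega> - v * t (Suc i)) - (B (t i) \<omega> - v * t i)"
    for B :: "real \<Rightarrow> 'a \<Rightarrow> real" and v i \<omega>
  let ?I = "{..<Suc k}"
  have I: "finite ?I" "?I \<noteq> {}" by auto
  let ?Z = "\<lambda>i \<omega>. (X B1 v1 i \<omega>, X B2 v2 i \<omega>)"
  have iv: "indep_vars (\<lambda>_. borel) (X B1 v1) ?I" "indep_vars (\<lambda>_. borel) (X B2 v2) ?I"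
    unfolding X_def[abs_def] using t_less t_nonneg
    by (intro indep_vars_drifted_increments B1 B2 t_nonneg less_imp_le t_less)+
  have Xm[measurable]: "X B1 v1 i \<in> borel_measurable M" "X B2 v2 i \<in> borel_measurable M" for i
    unfolding X_def[abs_def] using t_nonneg by measurable
  \<comment> \<open>The increments are measurable functions of the whole path, so independence of
    the two paths descends to the increment vectors.\<close>
  let ?Y = "\<lambda>v f. \<lambda>i\<in>?I. (f (t (Suc i)) - v * t (Suc i)) - (f (t i) - v * t i)"
  have Ym: "?Y v \<in> measurable path_space (PiM ?I (\<lambda>_. borel))" for v
  proof (rule measurable_restrict)
    fix i
    have [measurable]: "(\<lambda>f. f (t j)) \<in> borel_measurable path_space" for j
      unfolding path_space_def by (rule measurable_component_singleton) (simp add: t_nonneg)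
    show "(\<lambda>f. (f (t (Suc i)) - v * t (Suc i)) - (f (t i) - v * t i)) \<in> borel_measurable path_space"
      by measurable
  qed
  have YX: "?Y v \<circ> sample_path B = (\<lambda>\<omega>. \<lambda>i\<in>?I. X B v i \<omega>)" for B v
    using t_nonneg by (auto simp: fun_eq_iff X_def sample_path_def)
  have ipv: "indep_var (PiM ?I (\<lambda>_. borel)) (\<lambda>\<omega>. \<lambda>i\<in>?I. X B1 v1 i \<omega>)
                   (PiM ?I (\<lambda>_. borel)) (\<lambda>\<omega>. \<lambda>i\<in>?I. X B2 v2 i \<omega>)"
    using indep_var_compose[OF ind[unfolded independent_processes_def] Ym[of v1] Ym[of v2]]
    by (simp only: YX)
  have "indep_vars (\<lambda>_. borel \<Otimes>\<^sub>M borel) ?Z ?I"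
    by (rule indep_vars_pairI[OF I iv ipv])
  then have ivZ: "indep_vars (\<lambda>_. borel) ?Z ?I"
    by (simp add: borel_prod)
  have law: "distr M borel (?Z i) = gauss2 v1 v2 (t (Suc i) - t i)" if i: "i \<in> ?I" for i
  proof -
    have "indep_var borel ((\<lambda>f. f i) \<circ> (\<lambda>\<omega>. \<lambda>i\<in>?I. X B1 v1 i \<omega>)) borel ((\<lambda>f. f i) \<circ> (\<lambda>\<omega>. \<lambda>i\<in>?I. X B2 v2 i \<omega>))"
      by (rule indep_var_compose[OF ipv]; rule measurable_component_singleton[OF i])
    then have "indep_var borel (X B1 v1 i) borel (X B2 v2 i)"
      using i by (simp add: comp_def)
    then have "distr M borel (X B1 v1 i) \<Otimes>\<^sub>M distr M borel (X B2 v2 i) = distr M (borel \<Otimes>\<^sub>M borel) (?Z i)"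
      by (simp add: indep_var_distribution_eq)
    then show ?thesis
      unfolding gauss2_def X_def[abs_def]
      by (simp add: gauss_increment[OF B1 t_nonneg t_less] gauss_increment[OF B2 t_nonneg t_less] borel_prod)
  qed
  let ?m = "\<lambda>i. if i = 0 then gauss2 v1 v2 t0 else gauss2 v1 v2 h"
  have "distr M (PiM ?I (\<lambda>_. borel)) (\<lambda>\<omega>. \<lambda>i\<in>?I. ?Z i \<omega>) = PiM ?I (\<lambda>i. distr M borel (?Z i))"
    using ivZ by (subst (asm) indep_vars_iff_distr_eq_PiM'[OF I(2)]) (auto simp: borel_prod[symmetric])
  also have "\<dots> = PiM ?I ?m"
  proof (intro PiM_cong refl)
    fix i assume "i \<in> ?I"
    moreover have "t (Suc i) - t i = (if i = 0 then t0 else h)"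
      by (cases i) (auto simp: t_def algebra_simps)
    ultimately show "distr M borel (?Z i) = ?m i" by (simp add: law)
  qed
  finally have vec: "distr M (PiM ?I (\<lambda>_. borel)) (\<lambda>\<omega>. \<lambda>i\<in>?I. ?Z i \<omega>) = PiM ?I ?m" .
  let ?S = "{x. \<exists>j\<in>{1..Suc k}. (\<Sum>i<j. x i) \<in> U}"
  have Zm: "(\<lambda>\<omega>. \<lambda>i\<in>?I. ?Z i \<omega>) \<in> measurable M (PiM ?I (\<lambda>_. borel))"
    by (intro measurable_restrict) (auto simp: borel_prod[symmetric])
  have "\<And>i. sets (?m i) = sets borel" by simp
  from measurable_walk_hit[OF U this order_refl, of "Suc k"]
  have Sm: "?S \<inter> space (PiM ?I ?m) \<in> sets (PiM ?I ?m)"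
    by (simp add: pred_def Int_def conj_commute)
  have sP: "sets (PiM ?I ?m) = sets (PiM ?I (\<lambda>_. borel))"
    by (intro sets_PiM_cong) auto
  have "(\<integral>\<^sup>+w. hit U (gauss2 v1 v2 h) k w \<partial>gauss2 v1 v2 t0) = (\<integral>\<^sup>+x. indicator ?S x \<partial>PiM ?I ?m)"
    using t0 h by (intro walk_hit_probability[symmetric] U prob_space_gauss2) auto
  also have "\<dots> = (\<integral>\<^sup>+x. indicator (?S \<inter> space (PiM ?I ?m)) x \<partial>PiM ?I ?m)"
    by (intro nn_integral_cong) (auto simp: indicator_def)
  also have "\<dots> = emeasure (PiM ?I ?m) (?S \<inter> space (PiM ?I ?m))"
    using Sm by simp
  also have "\<dots> = emeasure M ((\<lambda>\<omega>. \<lambda>i\<in>?I. ?Z i \<omega>) -` (?S \<inter> space (PiM ?I ?m)) \<inter> space M)"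
    using Sm unfolding vec[symmetric] by (subst emeasure_distr[OF Zm]) auto
  also have vimage: "(\<lambda>\<omega>. \<lambda>i\<in>?I. ?Z i \<omega>) -` (?S \<inter> space (PiM ?I ?m)) \<inter> space M =
      {\<omega> \<in> space M. \<exists>j\<in>{1..Suc k}. (\<Sum>i<j. ?Z i \<omega>) \<in> U}" (is "_ = ?H'")
  proof -
    have "(\<lambda>\<omega>. \<lambda>i\<in>?I. ?Z i \<omega>) -` (?S \<inter> space (PiM ?I ?m)) \<inter> space M =
       {\<omega> \<in> space M. \<exists>j\<in>{1..Suc k}. (\<Sum>i<j. (\<lambda>i\<in>?I. ?Z i \<omega>) i) \<in> U}"
      by (auto simp: space_PiM sets_eq_imp_space_eq[OF sets_gauss2])
    also have "\<dots> = ?H'"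
    proof -
      have "(\<Sum>i<j. (\<lambda>i\<in>?I. ?Z i \<omega>) i) = (\<Sum>i<j. ?Z i \<omega>)" if "j \<in> {1..Suc k}" for j \<omega>
        using that by (intro sum.cong) auto
      then show ?thesis by (intro Collect_cong conj_cong bex_cong refl) simp
    qed
    finally show ?thesis .
  qed
  \<comment> \<open>Sums of increments telescope to the drifted position only if the path starts at
    0, so the two events agree only almost surely.\<close>
  also have "emeasure M ?H' = emeasure M ?H"
  proof (rule emeasure_eq_AE)
    have "AE \<omega> in M. B1 0 \<omega> = 0" "AE \<omega> in M. B2 0 \<omega> = 0"
      using B1 B2 by (auto simp: standard_brownian_motion_def)
    then show "AE \<omega> in M. \<omega> \<in> ?H' \<longleftrightarrow> \<omega> \<in> ?H"
    proof eventually_elim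
      fix \<omega> assume z: "B1 0 \<omega> = 0" "B2 0 \<omega> = 0"
      have s: "(\<Sum>i<j. ?Z i \<omega>) = (B1 (t j) \<omega> - v1 * t j, B2 (t j) \<omega> - v2 * t j)" for j
        by (induction j) (auto simp: z t_0 X_def zero_prod_def)
      have "(\<exists>j\<in>{1..Suc k}. P (t j)) \<longleftrightarrow> (\<exists>j\<le>k. P (t0 + real j * h))" for P
      proof -
        have "{1..Suc k} = Suc ` {..k}" by (simp add: image_Suc_atMost)
        then show ?thesis by (auto simp: t_Suc)
      qed
      from this[of "\<lambda>t. (B1 t \<omega> - v1 * t, B2 t \<omega> - v2 * t) \<in> U"]
      show "\<omega> \<in> ?H' \<longleftrightarrow> \<omega> \<in> ?H" by (simp add: s)
    qed
    have p: "(\<lambda>\<omega>. (f \<omega>, g \<omega>)) \<in> borel_measurable M" if "f \<in> borel_measurable M" "g \<in> borel_measurable M"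
      for f g :: "'a \<Rightarrow> real"
      using that by (simp add: borel_prod[symmetric])
    have "(\<lambda>\<omega>. \<lambda>i\<in>?I. ?Z i \<omega>) -` (?S \<inter> space (PiM ?I ?m)) \<inter> space M \<in> sets M"
      using Sm sP by (intro measurable_sets[OF Zm]) simp
    then show "?H' \<in> sets M" by (simp only: vimage)
    have f: "(\<lambda>\<omega>. (B1 (t0 + real j * h) \<omega> - v1 * (t0 + real j * h),
             B2 (t0 + real j * h) \<omega> - v2 * (t0 + real j * h))) \<in> borel_measurable M" (is "?f j \<in> _") for j
      using t_nonneg[of "Suc j"] by (intro p borel_measurable_diff) (auto simp: t_Suc)
    have "?H = (\<Union>j\<in>{..k}. ?f j -` U \<inter> space M)" by auto
    also have "\<dots> \<in> sets M"
      by (intro sets.finite_UN measurable_sets[OF f U]) simp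
    finally show "?H \<in> sets M" .
  qed
  finally show ?thesis ..
qed

section \<open>Gaussian estimates for the ruin set\<close>

text \<open>Completing the square: the tilt moves the mean of the normal density by
  \<open>\<alpha> * t\<close> and keeps the variance.\<close>

lemma gauss_mgf:
  assumes "0 < t"
  shows "(\<integral>\<^sup>+z. ennreal (exp (\<alpha> * z)) \<partial>gauss v t) = ennreal (exp (t * (\<alpha>\<^sup>2 / 2 - \<alpha> * v)))"
proof -
  have eq: "normal_density (- (v * t)) (sqrt t) z * exp (\<alpha> * z) =
      exp (t * (\<alpha>\<^sup>2 / 2 - \<alpha> * v)) * normal_density (- (v * t) + \<alpha> * t) (sqrt t) z" for z
  proof -
    have "- (z - - (v * t))\<^sup>2 / (2 * t) + \<alpha> * z =
        t * (\<alpha>\<^sup>2 / 2 - \<alpha> * v) + - (z - (- (v * t) + \<alpha> * t))\<^sup>2 / (2 * t)"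
      using assms by (simp add: field_simps power2_eq_square)
    then have "exp (- (z - - (v * t))\<^sup>2 / (2 * t)) * exp (\<alpha> * z) =
        exp (t * (\<alpha>\<^sup>2 / 2 - \<alpha> * v)) * exp (- (z - (- (v * t) + \<alpha> * t))\<^sup>2 / (2 * t))"
      by (simp only: exp_add[symmetric])
    then show ?thesis
      using assms by (simp add: normal_density_def)
  qed
  have "(\<integral>\<^sup>+z. ennreal (exp (\<alpha> * z)) \<partial>gauss v t) =
      (\<integral>\<^sup>+z. ennreal (normal_density (- (v * t)) (sqrt t) z) * ennreal (exp (\<alpha> * z)) \<partial>lborel)"
    unfolding gauss_def by (subst nn_integral_density) auto
  also have "\<dots> = (\<integral>\<^sup>+z. ennreal (exp (t * (\<alpha>\<^sup>2 / 2 - \<alpha> * v))) *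
      ennreal (normal_density (- (v * t) + \<alpha> * t) (sqrt t) z) \<partial>lborel)"
    by (intro nn_integral_cong) (simp add: ennreal_mult'[symmetric] eq)
  also have "\<dots> = ennreal (exp (t * (\<alpha>\<^sup>2 / 2 - \<alpha> * v))) *
      (\<integral>\<^sup>+z. ennreal (normal_density (- (v * t) + \<alpha> * t) (sqrt t) z) \<partial>lborel)"
    by (subst nn_integral_cmult) auto
  also have "(\<integral>\<^sup>+z. ennreal (normal_density (- (v * t) + \<alpha> * t) (sqrt t) z) \<partial>lborel) = 1"
    using assms by (subst nn_integral_eq_integral) auto
  finally show ?thesis by simp
qed

lemma exp_linear_borel[measurable]:
  "(\<lambda>w :: real \<times> real. exp (\<alpha> * fst w + \<beta> * snd w)) \<in> borel_measurable borel"
  by (intro borel_measurable_continuous_onI continuous_intros)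

lemma gauss2_mgf:
  assumes "0 < t"
  shows "(\<integral>\<^sup>+w. ennreal (exp (\<alpha> * fst w + \<beta> * snd w)) \<partial>gauss2 v1 v2 t) =
    ennreal (exp (t * (\<alpha>\<^sup>2 / 2 + \<beta>\<^sup>2 / 2 - \<alpha> * v1 - \<beta> * v2)))"
proof -
  interpret G: prob_space "gauss v2 t" using assms by (rule prob_space_gauss)
  have "(\<integral>\<^sup>+w. ennreal (exp (\<alpha> * fst w + \<beta> * snd w)) \<partial>gauss2 v1 v2 t) =
      (\<integral>\<^sup>+x. \<integral>\<^sup>+y. ennreal (exp (\<alpha> * x)) * ennreal (exp (\<beta> * y)) \<partial>gauss v2 t \<partial>gauss v1 t)"
    unfolding gauss2_def by (subst G.nn_integral_fst[symmetric]) (auto simp: exp_add ennreal_mult')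
  also have "\<dots> = (\<integral>\<^sup>+x. ennreal (exp (\<alpha> * x)) * ennreal (exp (t * (\<beta>\<^sup>2 / 2 - \<beta> * v2))) \<partial>gauss v1 t)"
    using assms by (simp add: nn_integral_cmult gauss_mgf)
  also have "\<dots> = ennreal (exp (t * (\<alpha>\<^sup>2 / 2 - \<alpha> * v1))) * ennreal (exp (t * (\<beta>\<^sup>2 / 2 - \<beta> * v2)))"
    using assms by (simp add: nn_integral_multc gauss_mgf)
  also have "\<dots> = ennreal (exp (t * (\<alpha>\<^sup>2 / 2 + \<beta>\<^sup>2 / 2 - \<alpha> * v1 - \<beta> * v2)))"
    by (simp add: ennreal_mult'[symmetric] exp_add[symmetric] algebra_simps)
  finally show ?thesis .
qed

text \<open>
  In the coordinates \<open>(B1, B2)\<close>, \<open>u * (1, corner a \<rho>)\<close> is the point of the closure of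
  \<open>ruin_set a \<rho> u\<close> that is nearest to the origin, at squared distance \<open>q_const a \<rho> * u\<^sup>2\<close>.
\<close>

definition ruin_set :: "real \<Rightarrow> real \<Rightarrow> real \<Rightarrow> (real \<times> real) set" where
  "ruin_set a \<rho> u = {w. fst w > u \<and> \<rho> * fst w + sqrt (1 - \<rho>\<^sup>2) * snd w > a * u}"

definition corner :: "real \<Rightarrow> real \<Rightarrow> real" where
  "corner a \<rho> = max 0 ((a - \<rho>) / sqrt (1 - \<rho>\<^sup>2))"

lemma ruin_set_borel[measurable]: "ruin_set a \<rho> u \<in> sets borel"
proof -
  have "ruin_set a \<rho> u = {w. u < fst w} \<inter> {w. a * u < \<rho> * fst w + sqrt (1 - \<rho>\<^sup>2) * snd w}"
    by (auto simp: ruin_set_def)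
  also have "open \<dots>" by (intro open_Int open_Collect_less continuous_intros)
  finally show ?thesis by simp
qed

lemma corner_nonneg: "0 \<le> corner a \<rho>"
  by (simp add: corner_def)

lemma one_minus_square_pos:
  assumes "-1 < \<rho>" "\<rho> < (1::real)"
  shows "0 < 1 - \<rho>\<^sup>2"
  using assms by (simp add: abs_square_less_1 abs_if)

lemma q_const_eq:
  assumes "-1 < \<rho>" "\<rho> < 1"
  shows "q_const a \<rho> = 1 + (corner a \<rho>)\<^sup>2"
proof (cases "a > \<rho>")
  case True
  note pos = one_minus_square_pos[OF assms]
  have "(corner a \<rho>)\<^sup>2 = (a - \<rho>)\<^sup>2 / (1 - \<rho>\<^sup>2)"
    using True pos by (simp add: corner_def max_def power_divide)
  then show ?thesis
    using True pos by (simp add: q_const_def field_simps power2_eq_square)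
next
  case False
  then have "(a - \<rho>) / sqrt (1 - \<rho>\<^sup>2) \<le> 0"
    using one_minus_square_pos[OF assms] by (simp add: divide_nonpos_nonneg)
  then show ?thesis using False by (simp add: q_const_def corner_def)
qed

lemma q_const_ge_1:
  assumes "-1 < \<rho>" "\<rho> < 1"
  shows "1 \<le> q_const a \<rho>"
  by (simp add: q_const_eq[OF assms])

text \<open>The two inequalities defining the ruin set are added with weights
  \<open>s - d * \<rho>\<close> and \<open>d\<close>; the result is the half plane whose normal
  points to the nearest point. The first weight is positive exactly when
  \<open>a * \<rho> < 1\<close>, and here \<open>a \<le> 1\<close> enters. For
  \<open>a \<le> \<rho>\<close> the first inequality is already the claim.\<close>

lemma ruin_set_halfplane:
  assumes "a \<le> 1" "-1 < \<rho>" "\<rho> < 1" and w: "w \<in> ruin_set a \<rho> u"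
  shows "q_const a \<rho> * u \<le> fst w + corner a \<rho> * snd w"
proof (cases "a > \<rho>")
  case True
  define s where "s = sqrt (1 - \<rho>\<^sup>2)"
  note pos = one_minus_square_pos[OF assms(2,3)]
  have s: "0 < s" "s\<^sup>2 = 1 - \<rho>\<^sup>2" using pos by (auto simp: s_def)
  define d where "d = (a - \<rho>) / s"
  have d: "corner a \<rho> = d" "0 < d" "d * s = a - \<rho>"
    using True s by (auto simp: corner_def d_def s_def max_def)
  \<comment> \<open>For negative \<rho> the relations \<open>-1 < \<rho>\<close> and
    \<open>\<rho> < a \<le> 1\<close> give \<open>\<bar>a\<bar> \<le> 1\<close>.\<close>
  have "a * \<rho> < 1"
  proof (cases "\<rho> \<ge> 0")
    case True
    then have "a * \<rho> \<le> 1 * \<rho>" using assms by (intro mult_right_mono) auto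
    then show ?thesis using assms by simp
  next
    case False
    have "a * \<rho> \<le> \<bar>a\<bar> * \<bar>\<rho>\<bar>" by (metis abs_ge_self abs_mult)
    also have "\<dots> \<le> 1 * \<bar>\<rho>\<bar>" using assms True False by (intro mult_right_mono) auto
    finally show ?thesis using assms by simp
  qed
  moreover have "(s - d * \<rho>) * s = 1 - a * \<rho>"
  proof -
    have "(s - d * \<rho>) * s = s\<^sup>2 - (d * s) * \<rho>" by (simp add: algebra_simps power2_eq_square)
    then show ?thesis by (simp add: s d) (simp add: algebra_simps power2_eq_square)
  qed
  ultimately have "0 < (s - d * \<rho>) * s" by simp
  then have nn: "0 < s - d * \<rho>" using s by (simp add: zero_less_mult_iff)
  have w1: "u < fst w" and w2: "a * u < \<rho> * fst w + s * snd w"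
    using w by (auto simp: ruin_set_def s_def)
  have "(s - d * \<rho>) * u + d * (a * u) \<le> (s - d * \<rho>) * fst w + d * (\<rho> * fst w + s * snd w)"
    using w1 w2 nn d by (intro add_mono mult_left_mono) auto
  also have "\<dots> = s * (fst w + d * snd w)" by (simp add: algebra_simps)
  also have "(s - d * \<rho>) * u + d * (a * u) = (s + d * (a - \<rho>)) * u" by (simp add: algebra_simps)
  also have "\<dots> = s * ((1 + d\<^sup>2) * u)"
    unfolding d(3)[symmetric] by (simp add: algebra_simps power2_eq_square)
  finally have "(1 + d\<^sup>2) * u \<le> fst w + d * snd w"
    using s by (simp only: mult_le_cancel_left_pos)
  then show ?thesis by (simp add: q_const_eq[OF assms(2,3)] d)
next
  case False
  then have "(a - \<rho>) / sqrt (1 - \<rho>\<^sup>2) \<le> 0"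
    using one_minus_square_pos[OF assms(2,3)] by (simp add: divide_nonpos_nonneg)
  then have "corner a \<rho> = 0" by (simp add: corner_def)
  then show ?thesis
    using w by (simp add: q_const_eq[OF assms(2,3)] ruin_set_def)
qed

lemma drift_exponent_le:
  fixes u d v1 v2 :: real
  assumes "0 < u" "0 \<le> d"
  shows "u\<^sup>2 / 2 + (u * d)\<^sup>2 / 2 - u * v1 - (u * d) * v2 \<le> u\<^sup>2 * (1 + d\<^sup>2) / 2 + u * (\<bar>v1\<bar> + d * \<bar>v2\<bar>)"
proof -
  have "u * (- v1) \<le> u * \<bar>v1\<bar>" using assms by (intro mult_left_mono) auto
  moreover have "u * d * (- v2) \<le> u * d * \<bar>v2\<bar>" using assms by (intro mult_left_mono) auto
  ultimately show ?thesis by (simp add: algebra_simps power2_eq_square add_divide_distrib)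
qed

section \<open>Chernoff bounds for ruin on a grid\<close>

text \<open>The tilt in direction \<open>(1, d)\<close> with strength \<open>u\<close> is at least 1
  on the ruin set by the half plane bound, and each step multiplies its expectation by at most a
  fixed factor. The bound sees \<open>k\<close> and \<open>h\<close> only through
  \<open>real k * h\<close>, which makes it uniform under grid refinement.\<close>

lemma hit_exponential_bound:
  assumes \<rho>: "a \<le> 1" "-1 < \<rho>" "\<rho> < 1" and "0 < u" "0 < h"
  shows "hit (ruin_set a \<rho> u) (gauss2 v1 v2 h) k w \<le>
    ennreal (exp (u * (fst w + corner a \<rho> * snd w - q_const a \<rho> * u)
       + (real k * h) * (u\<^sup>2 * q_const a \<rho> / 2 + u * (\<bar>v1\<bar> + corner a \<rho> * \<bar>v2\<bar>))))"
proof -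
  define d where "d = corner a \<rho>"
  define q where "q = q_const a \<rho>"
  have q: "q = 1 + d\<^sup>2" unfolding q_def d_def by (rule q_const_eq[OF \<rho>(2,3)])
  have d0: "0 \<le> d" by (simp add: d_def corner_nonneg)
  define \<kappa> where "\<kappa> = u\<^sup>2 * q / 2 + u * (\<bar>v1\<bar> + d * \<bar>v2\<bar>)"
  have "0 \<le> \<kappa>" unfolding \<kappa>_def q using \<open>0 < u\<close> d0 by (intro add_nonneg_nonneg mult_nonneg_nonneg divide_nonneg_nonneg) auto
  let ?F = "\<lambda>w. ennreal (exp (u * (fst w + d * snd w - q * u)))"
  have "hit (ruin_set a \<rho> u) (gauss2 v1 v2 h) k w \<le> ennreal (exp (h * \<kappa>)) ^ k * ?F w"
  proof (rule hit_le_supermartingale)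
    show "1 \<le> ?F w" if "w \<in> ruin_set a \<rho> u" for w
      using ruin_set_halfplane[OF \<rho> that] \<open>0 < u\<close> by (simp add: d_def q_def)
    show "1 \<le> ennreal (exp (h * \<kappa>))" using \<open>0 < h\<close> \<open>0 \<le> \<kappa>\<close> by simp
    show "(\<integral>\<^sup>+ z. ?F (w + z) \<partial>gauss2 v1 v2 h) \<le> ennreal (exp (h * \<kappa>)) * ?F w" for w
    proof -
      have "(\<integral>\<^sup>+ z. ?F (w + z) \<partial>gauss2 v1 v2 h) =
          (\<integral>\<^sup>+ z. ?F w * ennreal (exp (u * fst z + (u * d) * snd z)) \<partial>gauss2 v1 v2 h)"
        by (intro nn_integral_cong)
           (simp add: ennreal_mult'[symmetric] exp_add[symmetric] algebra_simps)
      also have "\<dots> = ?F w * ennreal (exp (h * (u\<^sup>2 / 2 + (u * d)\<^sup>2 / 2 - u * v1 - (u * d) * v2)))"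
        using exp_linear_borel by (subst nn_integral_cmult) (auto simp: gauss2_mgf \<open>0 < h\<close> measurable_cong_sets[OF sets_gauss2 refl])
      also have "\<dots> \<le> ?F w * ennreal (exp (h * \<kappa>))"
      proof -
        have "u\<^sup>2 / 2 + (u * d)\<^sup>2 / 2 - u * v1 - (u * d) * v2 \<le> \<kappa>"
          using drift_exponent_le[OF \<open>0 < u\<close> d0] by (simp add: \<kappa>_def q)
        then show ?thesis using \<open>0 < h\<close> by (intro mult_left_mono ennreal_leI) auto
      qed
      finally show ?thesis by (simp add: mult.commute)
    qed
    have "(\<lambda>w :: real \<times> real. exp (u * (fst w + d * snd w - q * u))) \<in> borel_measurable borel"
      by (intro borel_measurable_continuous_onI continuous_intros)
    then show "?F \<in> borel_measurable borel" by (rule measurable_compose) simp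
  qed simp
  also have "ennreal (exp (h * \<kappa>)) ^ k * ?F w = ennreal (exp (u * (fst w + d * snd w - q * u) + (real k * h) * \<kappa>))"
    by (simp add: ennreal_power ennreal_mult'[symmetric] exp_of_nat_mult[symmetric] exp_add[symmetric] mult.assoc add.commute)
  finally show ?thesis by (simp add: d_def q_def \<kappa>_def)
qed

text \<open>The starting law is integrated with the same tilt, so starting time and walking time add
  up. Total time 1/2 gives leading exponent -3 q u^2/4, total time 1 gives -q u^2/2.\<close>

lemma hit_probability_upper:
  assumes \<rho>: "a \<le> 1" "-1 < \<rho>" "\<rho> < 1" and "0 < u" "0 < h" "0 < t"
  shows "(\<integral>\<^sup>+w. hit (ruin_set a \<rho> u) (gauss2 v1 v2 h) k w \<partial>gauss2 v1 v2 t) \<le>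
    ennreal (exp (- q_const a \<rho> * u\<^sup>2 +
       (t + real k * h) * (u\<^sup>2 * q_const a \<rho> / 2 + u * (\<bar>v1\<bar> + corner a \<rho> * \<bar>v2\<bar>))))"
proof -
  define d where "d = corner a \<rho>"
  define q where "q = q_const a \<rho>"
  have q: "q = 1 + d\<^sup>2" unfolding q_def d_def by (rule q_const_eq[OF \<rho>(2,3)])
  have d0: "0 \<le> d" by (simp add: d_def corner_nonneg)
  define \<kappa> where "\<kappa> = u\<^sup>2 * q / 2 + u * (\<bar>v1\<bar> + d * \<bar>v2\<bar>)"
  have "(\<integral>\<^sup>+w. hit (ruin_set a \<rho> u) (gauss2 v1 v2 h) k w \<partial>gauss2 v1 v2 t) \<le>
     (\<integral>\<^sup>+w. ennreal (exp (- q * u\<^sup>2 + (real k * h) * \<kappa>)) * ennreal (exp (u * fst w + (u * d) * snd w)) \<partial>gauss2 v1 v2 t)"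
  proof (intro nn_integral_mono)
    fix w
    have "ennreal (exp (- q * u\<^sup>2 + (real k * h) * \<kappa>)) * ennreal (exp (u * fst w + (u * d) * snd w)) =
      ennreal (exp (u * (fst w + d * snd w - q * u) + (real k * h) * \<kappa>))"
      by (simp add: ennreal_mult'[symmetric] exp_add[symmetric] algebra_simps power2_eq_square)
    then show "hit (ruin_set a \<rho> u) (gauss2 v1 v2 h) k w \<le>
      ennreal (exp (- q * u\<^sup>2 + (real k * h) * \<kappa>)) * ennreal (exp (u * fst w + (u * d) * snd w))"
      using hit_exponential_bound[OF assms(1-5), of v1 v2 k w] by (simp add: d_def q_def \<kappa>_def)
  qed
  also have "\<dots> = ennreal (exp (- q * u\<^sup>2 + (real k * h) * \<kappa>)) *
      ennreal (exp (t * (u\<^sup>2 / 2 + (u * d)\<^sup>2 / 2 - u * v1 - (u * d) * v2)))"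
    using exp_linear_borel by (subst nn_integral_cmult) (auto simp: gauss2_mgf \<open>0 < t\<close> measurable_cong_sets[OF sets_gauss2 refl])
  also have "\<dots> \<le> ennreal (exp (- q * u\<^sup>2 + (real k * h) * \<kappa>)) * ennreal (exp (t * \<kappa>))"
  proof -
    have "u\<^sup>2 / 2 + (u * d)\<^sup>2 / 2 - u * v1 - (u * d) * v2 \<le> \<kappa>"
      using drift_exponent_le[OF \<open>0 < u\<close> d0] by (simp add: \<kappa>_def q)
    then show ?thesis using \<open>0 < t\<close> by (intro mult_left_mono ennreal_leI) auto
  qed
  also have "\<dots> = ennreal (exp (- q * u\<^sup>2 + (t + real k * h) * \<kappa>))"
    by (simp add: ennreal_mult'[symmetric] exp_add[symmetric] algebra_simps)
  finally show ?thesis by (simp add: d_def q_def \<kappa>_def)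
qed

text \<open>The centre is where the straight path reaching the nearest point at time 1 stands at
  time 1/2. A box instead of a disc has a complement covered by four half planes.\<close>

definition bulk :: "real \<Rightarrow> real \<Rightarrow> real \<Rightarrow> (real \<times> real) set" where
  "bulk d \<eta> u = {w. \<bar>fst w - u / 2\<bar> \<le> \<eta> * u \<and> \<bar>snd w - d * u / 2\<bar> \<le> \<eta> * u}"

lemma bulk_borel[measurable]: "bulk d \<eta> u \<in> sets borel"
proof -
  have "bulk d \<eta> u = {w. \<bar>fst w - u / 2\<bar> \<le> \<eta> * u} \<inter> {w. \<bar>snd w - d * u / 2\<bar> \<le> \<eta> * u}"
    by (auto simp: bulk_def)
  also have "closed \<dots>" by (intro closed_Int closed_Collect_le continuous_intros)
  finally show ?thesis by simp
qed

text \<open>Chernoff bound: each of the four half planes covering the complement of the bulk costs an extra exponential tilt.\<close>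

lemma hit_outside_bulk:
  assumes \<rho>: "a \<le> 1" "-1 < \<rho>" "\<rho> < 1" and "0 < u" "0 < h" "0 < \<eta>" and kh: "real k * h = 1 / 2"
  defines "d \<equiv> corner a \<rho>" and "q \<equiv> q_const a \<rho>"
  shows "(\<integral>\<^sup>+w. hit (ruin_set a \<rho> u) (gauss2 v1 v2 h) k w * indicator (- bulk d \<eta> u) w \<partial>gauss2 v1 v2 (1/2)) \<le>
    ennreal (4 * exp (- (q * u\<^sup>2 / 2) - 3 / 4 * \<eta>\<^sup>2 * u\<^sup>2 + (1 + \<eta>) * (\<bar>v1\<bar> + d * \<bar>v2\<bar> + \<bar>v2\<bar>) * u))"
proof -
  have q: "q = 1 + d\<^sup>2" unfolding q_def d_def by (rule q_const_eq[OF \<rho>(2,3)])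
  have d0: "0 \<le> d" by (simp add: d_def corner_nonneg)
  define c where "c = - (q * u\<^sup>2) + (u\<^sup>2 * q / 2 + u * (\<bar>v1\<bar> + d * \<bar>v2\<bar>)) / 2"
  \<comment> \<open>\<open>E r s\<close> is the exponential bound for \<open>hit\<close> times a
    factor that is at least 1 beyond the face of the box with outer normal \<open>(r, s)\<close>;
    \<open>E_eq\<close> shows this form. Here it is split as a constant times one exponential, ready
    for \<open>gauss2_mgf\<close>.\<close>
  define E where "E r s w = ennreal (exp (c - \<eta>\<^sup>2 * u\<^sup>2 - r * \<eta> * u * (u / 2) - s * \<eta> * u * (d * u / 2))) *
     ennreal (exp ((u + r * \<eta> * u) * fst w + (u * d + s * \<eta> * u) * snd w))" for r s :: real and w :: "real \<times> real"
  have E_eq: "E r s w = ennreal (exp (u * (fst w + d * snd w - q * u) + 1/2 * (u\<^sup>2 * q / 2 + u * (\<bar>v1\<bar> + d * \<bar>v2\<bar>))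
       + (\<eta> * u * (r * (fst w - u / 2) + s * (snd w - d * u / 2) - \<eta> * u))))" for r s w
    unfolding E_def c_def
    by (simp add: ennreal_mult'[symmetric] exp_add[symmetric] algebra_simps power2_eq_square add_divide_distrib)
  have b: "hit (ruin_set a \<rho> u) (gauss2 v1 v2 h) k w \<le> E r s w"
    if "\<eta> * u \<le> r * (fst w - u / 2) + s * (snd w - d * u / 2)" for r s w
  proof -
    have "0 \<le> \<eta> * u * (r * (fst w - u / 2) + s * (snd w - d * u / 2) - \<eta> * u)"
      using that assms by (intro mult_nonneg_nonneg) auto
    then show ?thesis
      unfolding E_eq using hit_exponential_bound[OF assms(1-5), of v1 v2 k w, unfolded kh]
      by (intro order_trans[OF hit_exponential_bound[OF assms(1-5)]] ennreal_leI)
         (simp add: kh d_def q_def)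
  qed
  have pw: "hit (ruin_set a \<rho> u) (gauss2 v1 v2 h) k w * indicator (- bulk d \<eta> u) w
      \<le> (E 1 0 w + E (-1) 0 w) + (E 0 1 w + E 0 (-1) w)" for w
  proof (cases "w \<in> bulk d \<eta> u")
    case False
    then consider "\<eta> * u \<le> fst w - u / 2" | "\<eta> * u \<le> - (fst w - u / 2)" | "\<eta> * u \<le> snd w - d * u / 2" | "\<eta> * u \<le> - (snd w - d * u / 2)"
      unfolding bulk_def by fastforce
    then have "hit (ruin_set a \<rho> u) (gauss2 v1 v2 h) k w \<le> (E 1 0 w + E (-1) 0 w) + (E 0 1 w + E 0 (-1) w)"
    proof cases
      case 1 then have "hit (ruin_set a \<rho> u) (gauss2 v1 v2 h) k w \<le> E 1 0 w" by (intro b) simp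
      then show ?thesis by (simp add: add_increasing2)
    next
      case 2 then have "hit (ruin_set a \<rho> u) (gauss2 v1 v2 h) k w \<le> E (-1) 0 w" by (intro b) simp
      then show ?thesis by (simp add: add_increasing2 add_increasing)
    next
      case 3 then have "hit (ruin_set a \<rho> u) (gauss2 v1 v2 h) k w \<le> E 0 1 w" by (intro b) simp
      then show ?thesis by (simp add: add_increasing2 add_increasing)
    next
      case 4 then have "hit (ruin_set a \<rho> u) (gauss2 v1 v2 h) k w \<le> E 0 (-1) w" by (intro b) simp
      then show ?thesis by (simp add: add_increasing2 add_increasing)
    qed
    then show ?thesis using False by simp
  qed simp
  let ?R = "exp (- (q * u\<^sup>2 / 2) - 3 / 4 * \<eta>\<^sup>2 * u\<^sup>2 + (1 + \<eta>) * (\<bar>v1\<bar> + d * \<bar>v2\<bar> + \<bar>v2\<bar>) * u)"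
  have Em[measurable]: "E r s \<in> borel_measurable borel" for r s
    unfolding E_def[abs_def]
    by (intro borel_measurable_times_ennreal measurable_compose[OF exp_linear_borel measurable_ennreal] measurable_const) simp
  have I: "(\<integral>\<^sup>+w. E r s w \<partial>gauss2 v1 v2 (1/2)) \<le> ennreal ?R" if rs: "r\<^sup>2 + s\<^sup>2 = 1" "\<bar>r\<bar> \<le> 1" "\<bar>s\<bar> \<le> 1" for r s
  proof -
    let ?\<alpha> = "u + r * \<eta> * u" and ?\<beta> = "u * d + s * \<eta> * u"
    have "(\<integral>\<^sup>+w. E r s w \<partial>gauss2 v1 v2 (1/2)) =
      ennreal (exp (c - \<eta>\<^sup>2 * u\<^sup>2 - r * \<eta> * u * (u / 2) - s * \<eta> * u * (d * u / 2))) *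
      ennreal (exp (1/2 * (?\<alpha>\<^sup>2 / 2 + ?\<beta>\<^sup>2 / 2 - ?\<alpha> * v1 - ?\<beta> * v2)))"
      unfolding E_def using exp_linear_borel by (subst nn_integral_cmult) (auto simp: gauss2_mgf measurable_cong_sets[OF sets_gauss2 refl])
    also have "\<dots> = ennreal (exp (c - \<eta>\<^sup>2 * u\<^sup>2 - r * \<eta> * u * (u / 2) - s * \<eta> * u * (d * u / 2)
        + 1/2 * (?\<alpha>\<^sup>2 / 2 + ?\<beta>\<^sup>2 / 2 - ?\<alpha> * v1 - ?\<beta> * v2)))"
      by (simp add: ennreal_mult'[symmetric] exp_add[symmetric])
    \<comment> \<open>The centring of the box cancels the terms linear in \<eta> that carry u^2. For
      a unit normal, -\<eta>^2 u^2 + \<eta>^2 u^2/4 remains, which is the 3/4 of the bound.\<close>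
    also have "c - \<eta>\<^sup>2 * u\<^sup>2 - r * \<eta> * u * (u / 2) - s * \<eta> * u * (d * u / 2)
        + 1/2 * (?\<alpha>\<^sup>2 / 2 + ?\<beta>\<^sup>2 / 2 - ?\<alpha> * v1 - ?\<beta> * v2) =
       - (q * u\<^sup>2 / 2) - \<eta>\<^sup>2 * u\<^sup>2 + (r\<^sup>2 + s\<^sup>2) * \<eta>\<^sup>2 * u\<^sup>2 / 4 +
        u / 2 * (\<bar>v1\<bar> + d * \<bar>v2\<bar> + (1 + r * \<eta>) * (- v1) + (d + s * \<eta>) * (- v2))"
      unfolding c_def q by (simp add: field_simps power2_eq_square)
    also have "ennreal (exp \<dots>) \<le> ennreal ?R"
    proof -
      have "(1 + r * \<eta>) * (- v1) \<le> \<bar>(1 + r * \<eta>) * (- v1)\<bar>" by (rule abs_ge_self)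
      also have "\<dots> = \<bar>1 + r * \<eta>\<bar> * \<bar>v1\<bar>" by (simp add: abs_mult)
      also have "\<dots> \<le> (1 + \<eta>) * \<bar>v1\<bar>"
      proof (intro mult_right_mono)
        have "\<bar>r * \<eta>\<bar> \<le> \<eta>" using rs \<open>0 < \<eta>\<close> by (simp add: abs_mult)
        then show "\<bar>1 + r * \<eta>\<bar> \<le> 1 + \<eta>" by linarith
      qed simp
      finally have 1: "(1 + r * \<eta>) * (- v1) \<le> (1 + \<eta>) * \<bar>v1\<bar>" .
      have "(d + s * \<eta>) * (- v2) \<le> \<bar>(d + s * \<eta>) * (- v2)\<bar>" by (rule abs_ge_self)
      also have "\<dots> = \<bar>d + s * \<eta>\<bar> * \<bar>v2\<bar>" by (simp add: abs_mult)
      also have "\<dots> \<le> (d + \<eta>) * \<bar>v2\<bar>"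
      proof (intro mult_right_mono)
        have "\<bar>s * \<eta>\<bar> \<le> \<eta>" using rs \<open>0 < \<eta>\<close> by (simp add: abs_mult)
        then show "\<bar>d + s * \<eta>\<bar> \<le> d + \<eta>" using d0 by linarith
      qed simp
      finally have 2: "(d + s * \<eta>) * (- v2) \<le> (d + \<eta>) * \<bar>v2\<bar>" .
      have "\<bar>v1\<bar> + d * \<bar>v2\<bar> + (1 + r * \<eta>) * (- v1) + (d + s * \<eta>) * (- v2) \<le>
         \<bar>v1\<bar> + d * \<bar>v2\<bar> + (1 + \<eta>) * \<bar>v1\<bar> + (d + \<eta>) * \<bar>v2\<bar>"
        by (intro add_mono order_refl 1 2)
      also have "\<dots> \<le> 2 * ((1 + \<eta>) * (\<bar>v1\<bar> + d * \<bar>v2\<bar> + \<bar>v2\<bar>))"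
        using d0 \<open>0 < \<eta>\<close> by (simp add: algebra_simps add_increasing2)
      finally have "u / 2 * (\<bar>v1\<bar> + d * \<bar>v2\<bar> + (1 + r * \<eta>) * (- v1) + (d + s * \<eta>) * (- v2)) \<le>
          u / 2 * (2 * ((1 + \<eta>) * (\<bar>v1\<bar> + d * \<bar>v2\<bar> + \<bar>v2\<bar>)))"
        using \<open>0 < u\<close> by (intro mult_left_mono) auto
      then show ?thesis
        unfolding rs by (intro ennreal_leI) (simp add: algebra_simps)
    qed
    finally show ?thesis .
  qed
  have "(\<integral>\<^sup>+w. hit (ruin_set a \<rho> u) (gauss2 v1 v2 h) k w * indicator (- bulk d \<eta> u) w \<partial>gauss2 v1 v2 (1/2))
    \<le> (\<integral>\<^sup>+w. (E 1 0 w + E (-1) 0 w) + (E 0 1 w + E 0 (-1) w) \<partial>gauss2 v1 v2 (1/2))"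
    by (intro nn_integral_mono pw)
  also have "\<dots> = ((\<integral>\<^sup>+w. E 1 0 w \<partial>gauss2 v1 v2 (1/2)) + (\<integral>\<^sup>+w. E (-1) 0 w \<partial>gauss2 v1 v2 (1/2)))
      + ((\<integral>\<^sup>+w. E 0 1 w \<partial>gauss2 v1 v2 (1/2)) + (\<integral>\<^sup>+w. E 0 (-1) w \<partial>gauss2 v1 v2 (1/2)))"
    by (simp add: nn_integral_add)
  also have "\<dots> \<le> (ennreal ?R + ennreal ?R) + (ennreal ?R + ennreal ?R)"
    by (intro add_mono I) auto
  also have "\<dots> = ennreal (4 * ?R)" by (simp add: ennreal_plus[symmetric] del: ennreal_plus)
  finally show ?thesis .
qed

section \<open>Lower bound for ruin at time one\<close>

text \<open>The interval has length 1, and its points are at distance at most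
  \<open>\<alpha> + \<bar>v\<bar> + 1\<close> from the mean, so the density is bounded below by its
  value at that distance.\<close>

lemma gauss_interval_lower:
  assumes "0 \<le> \<alpha>"
  shows "ennreal (exp (- (\<alpha> + \<bar>v\<bar> + 1)\<^sup>2 / 2) / sqrt (2 * pi)) \<le> emeasure (gauss v 1) {\<alpha><..\<alpha> + 1}"
proof -
  let ?c = "exp (- (\<alpha> + \<bar>v\<bar> + 1)\<^sup>2 / 2) / sqrt (2 * pi)"
  have "ennreal ?c = (\<integral>\<^sup>+z. ennreal ?c * indicator {\<alpha><..\<alpha> + 1} z \<partial>lborel)"
    by (subst nn_integral_cmult_indicator) auto
  also have "\<dots> \<le> (\<integral>\<^sup>+z. ennreal (normal_density (- (v * 1)) (sqrt 1) z) * indicator {\<alpha><..\<alpha> + 1} z \<partial>lborel)"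
  proof (intro nn_integral_mono)
    fix z
    have "?c \<le> normal_density (- (v * 1)) (sqrt 1) z" if "z \<in> {\<alpha><..\<alpha> + 1}"
    proof -
      have "\<bar>z + v\<bar> \<le> \<alpha> + \<bar>v\<bar> + 1" using that assms by auto
      then have "(z + v)\<^sup>2 \<le> (\<alpha> + \<bar>v\<bar> + 1)\<^sup>2" by (metis abs_ge_zero power2_abs power_mono)
      then show ?thesis by (simp add: normal_density_def divide_right_mono)
    qed
    then show "ennreal ?c * indicator {\<alpha><..\<alpha> + 1} z \<le>
        ennreal (normal_density (- (v * 1)) (sqrt 1) z) * indicator {\<alpha><..\<alpha> + 1} z"
      by (auto simp: indicator_def intro: ennreal_leI)
  qed
  also have "\<dots> = emeasure (gauss v 1) {\<alpha><..\<alpha> + 1}"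
    unfolding gauss_def by (subst emeasure_density) auto
  finally show ?thesis .
qed

text \<open>A unit square just above the nearest point lies in the ruin set. Relative to the leading
  exponent the density there loses only a factor \<open>exp (- K * u)\<close>, up to a
  constant.\<close>

lemma ruin_set_lower:
  assumes \<rho>: "-1 < \<rho>" "\<rho> < 1"
  obtains C K where "0 < C" "\<And>u. 0 < u \<Longrightarrow>
    ennreal (C * exp (- (q_const a \<rho> * u\<^sup>2 / 2) - K * u)) \<le> emeasure (gauss2 v1 v2 1) (ruin_set a \<rho> u)"
proof -
  define s where "s = sqrt (1 - \<rho>\<^sup>2)"
  have s: "0 < s" using one_minus_square_pos[OF \<rho>] by (simp add: s_def)
  define d where "d = corner a \<rho>"
  have q: "q_const a \<rho> = 1 + d\<^sup>2" unfolding d_def by (rule q_const_eq[OF \<rho>])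
  have d0: "0 \<le> d" by (simp add: d_def corner_nonneg)
  \<comment> \<open>Upward shift of the square: for negative \<rho>, a first coordinate exceeding
    \<open>u\<close> by up to 1 lowers \<open>\<rho> * x + s * y\<close> by up to
    \<open>\<bar>\<rho>\<bar>\<close>, which is \<open>s * r\<close>.\<close>
  define r where "r = \<bar>\<rho>\<bar> / s"
  have r0: "0 \<le> r" using s by (simp add: r_def)
  define C1 where "C1 = \<bar>v1\<bar> + 1"
  define C2 where "C2 = r + \<bar>v2\<bar> + 1"
  show ?thesis
  proof
    show "0 < exp (- (C1\<^sup>2 + C2\<^sup>2) / 2) / (2 * pi)" by simp
    fix u :: real assume u: "0 < u"
    interpret G: prob_space "gauss v2 1" by (rule prob_space_gauss) simp
    have sub: "{u<..u + 1} \<times> {d * u + r<..d * u + r + 1} \<subseteq> ruin_set a \<rho> u"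
    proof (clarsimp simp: ruin_set_def s_def[symmetric])
      fix x y assume x: "u < x" "x \<le> u + 1" and y: "d * u + r < y"
      have "a - \<rho> \<le> s * d" using s by (simp add: d_def corner_def s_def[symmetric] max_def field_simps)
      then have "(a - \<rho>) * u \<le> s * d * u" using u by (intro mult_right_mono) auto
      moreover have "s * (d * u + r) < s * y" using y s by simp
      moreover have "s * r = \<bar>\<rho>\<bar>" using s by (simp add: r_def)
      moreover have "\<rho> * (u - x) \<le> \<bar>\<rho>\<bar> * 1"
      proof -
        have "\<rho> * (u - x) \<le> \<bar>\<rho>\<bar> * \<bar>u - x\<bar>" by (metis abs_ge_self abs_mult)
        also have "\<dots> \<le> \<bar>\<rho>\<bar> * 1" using x by (intro mult_left_mono) auto
        finally show ?thesis .
      qed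
      ultimately show "a * u < \<rho> * x + s * y" by (simp add: algebra_simps)
    qed
    have "ennreal (exp (- (C1\<^sup>2 + C2\<^sup>2) / 2) / (2 * pi) * exp (- (q_const a \<rho> * u\<^sup>2 / 2) - (C1 + d * C2) * u)) =
      ennreal (exp (- (u + \<bar>v1\<bar> + 1)\<^sup>2 / 2) / sqrt (2 * pi)) *
      ennreal (exp (- ((d * u + r) + \<bar>v2\<bar> + 1)\<^sup>2 / 2) / sqrt (2 * pi))"
    proof -
      have e: "- (u + \<bar>v1\<bar> + 1)\<^sup>2 / 2 + - ((d * u + r) + \<bar>v2\<bar> + 1)\<^sup>2 / 2 =
          - (C1\<^sup>2 + C2\<^sup>2) / 2 + (- (q_const a \<rho> * u\<^sup>2 / 2) - (C1 + d * C2) * u)"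
        unfolding q C1_def C2_def by (simp add: field_simps power2_eq_square)
      have "exp (- (u + \<bar>v1\<bar> + 1)\<^sup>2 / 2) / sqrt (2 * pi) * (exp (- ((d * u + r) + \<bar>v2\<bar> + 1)\<^sup>2 / 2) / sqrt (2 * pi))
        = exp (- (u + \<bar>v1\<bar> + 1)\<^sup>2 / 2 + - ((d * u + r) + \<bar>v2\<bar> + 1)\<^sup>2 / 2) / (2 * pi)"
        by (simp only: exp_add) (simp add: field_simps)
      also have "\<dots> = exp (- (C1\<^sup>2 + C2\<^sup>2) / 2) / (2 * pi) * exp (- (q_const a \<rho> * u\<^sup>2 / 2) - (C1 + d * C2) * u)"
        unfolding e by (simp only: exp_add) simp
      finally show ?thesis by (subst ennreal_mult[symmetric]) auto
    qed
    also have "\<dots> \<le> emeasure (gauss v1 1) {u<..u + 1} * emeasure (gauss v2 1) {d * u + r<..d * u + r + 1}"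
      using u d0 r0 by (intro mult_mono gauss_interval_lower) auto
    also have "\<dots> = emeasure (gauss2 v1 v2 1) ({u<..u + 1} \<times> {d * u + r<..d * u + r + 1})"
      unfolding gauss2_def by (subst G.emeasure_pair_measure_Times) auto
    also have "\<dots> \<le> emeasure (gauss2 v1 v2 1) (ruin_set a \<rho> u)"
      by (intro emeasure_mono sub) simp
    finally show "ennreal (exp (- (C1\<^sup>2 + C2\<^sup>2) / 2) / (2 * pi) * exp (- (q_const a \<rho> * u\<^sup>2 / 2) - (C1 + d * C2) * u))
        \<le> emeasure (gauss2 v1 v2 1) (ruin_set a \<rho> u)" .
  qed
qed

section \<open>Change of the starting time\<close>

text \<open>Density of the law at time \<open>1 / 2 - \<delta>\<close> with respect to the law at
  time 1/2. The drift gives only a constant factor, because the mixed term of (z + v t)^2 / (2 t) is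
  z v for every t.\<close>

definition start_ratio :: "real \<Rightarrow> real \<Rightarrow> real \<Rightarrow> real \<times> real \<Rightarrow> real" where
  "start_ratio v1 v2 \<delta> w = 1 / (1 - 2 * \<delta>) *
     exp (- ((fst w)\<^sup>2 + (snd w)\<^sup>2) * (2 * \<delta> / (1 - 2 * \<delta>)) + (v1\<^sup>2 + v2\<^sup>2) * \<delta> / 2)"

lemma start_ratio_borel[measurable]: "start_ratio v1 v2 \<delta> \<in> borel_measurable borel"
  unfolding start_ratio_def[abs_def]
  by (intro borel_measurable_continuous_onI continuous_intros)

lemma start_ratio_nonneg: "\<delta> < 1 / 2 \<Longrightarrow> 0 \<le> start_ratio v1 v2 \<delta> w"
  by (simp add: start_ratio_def)

lemma gauss_half_minus:
  assumes "0 \<le> \<delta>" "\<delta> < 1 / 2"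
  shows "gauss v (1 / 2 - \<delta>) = density (gauss v (1 / 2))
    (\<lambda>z. ennreal (1 / sqrt (1 - 2 * \<delta>) * exp (- z\<^sup>2 * (2 * \<delta> / (1 - 2 * \<delta>)) + v\<^sup>2 * \<delta> / 2)))"
proof -
  define s where "s = 1 - 2 * \<delta>"
  have s: "0 < s" and \<delta>: "\<delta> = (1 - s) / 2" using assms by (auto simp: s_def)
  have eq: "normal_density (- (v * (1 / 2 - \<delta>))) (sqrt (1 / 2 - \<delta>)) z = normal_density (- (v * (1 / 2))) (sqrt (1 / 2)) z *
      (1 / sqrt (1 - 2 * \<delta>) * exp (- z\<^sup>2 * (2 * \<delta> / (1 - 2 * \<delta>)) + v\<^sup>2 * \<delta> / 2))" for z
  proof -
    have "- (z - - (v * (s / 2)))\<^sup>2 / s = - (z - - (v * (1 / 2)))\<^sup>2 + (- z\<^sup>2 * ((1 - s) / s) + v\<^sup>2 * ((1 - s) / 2) / 2)"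
      using s by (simp add: field_simps power2_eq_square)
    then have "exp (- (z - - (v * (s / 2)))\<^sup>2 / s) =
       exp (- (z - - (v * (1 / 2)))\<^sup>2) * exp (- z\<^sup>2 * ((1 - s) / s) + v\<^sup>2 * ((1 - s) / 2) / 2)"
      by (simp only: exp_add[symmetric])
    moreover have e: "1 / 2 - \<delta> = s / 2" "1 - 2 * \<delta> = s" "2 * \<delta> = 1 - s" by (auto simp: s_def)
    moreover have "sqrt (2 * pi * (s / 2)) = sqrt pi * sqrt s" by (simp add: real_sqrt_mult)
    ultimately show ?thesis
      unfolding normal_density_def e(1) unfolding e(2) unfolding e(3) unfolding \<delta>
      using s by simp
  qed
  have "density (gauss v (1 / 2)) (\<lambda>z. ennreal (1 / sqrt (1 - 2 * \<delta>) * exp (- z\<^sup>2 * (2 * \<delta> / (1 - 2 * \<delta>)) + v\<^sup>2 * \<delta> / 2)))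
     = density lborel (\<lambda>z. ennreal (normal_density (- (v * (1 / 2))) (sqrt (1 / 2)) z) *
         ennreal (1 / sqrt (1 - 2 * \<delta>) * exp (- z\<^sup>2 * (2 * \<delta> / (1 - 2 * \<delta>)) + v\<^sup>2 * \<delta> / 2)))"
    unfolding gauss_def by (rule density_density_eq) measurable
  also have "\<dots> = gauss v (1 / 2 - \<delta>)"
    unfolding gauss_def eq by (intro density_cong AE_I2) (measurable, subst ennreal_mult'[symmetric], use assms in auto)
  finally show ?thesis ..
qed

lemma nn_integral_gauss2_half_minus:
  assumes \<delta>: "0 \<le> \<delta>" "\<delta> < 1 / 2" and F: "F \<in> borel_measurable borel"
  shows "(\<integral>\<^sup>+w. F w \<partial>gauss2 v1 v2 (1 / 2 - \<delta>)) =
    (\<integral>\<^sup>+w. ennreal (start_ratio v1 v2 \<delta> w) * F w \<partial>gauss2 v1 v2 (1 / 2))"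
proof -
  let ?r = "\<lambda>v z. ennreal (1 / sqrt (1 - 2 * \<delta>) * exp (- z\<^sup>2 * (2 * \<delta> / (1 - 2 * \<delta>)) + v\<^sup>2 * \<delta> / 2))"
  interpret G: prob_space "gauss v2 (1/2)" by (rule prob_space_gauss) simp
  interpret G': prob_space "gauss v2 (1/2 - \<delta>)" by (rule prob_space_gauss) (use \<delta> in simp)
  have "gauss2 v1 v2 (1 / 2 - \<delta>) = density (gauss2 v1 v2 (1 / 2)) (\<lambda>(x, y). ?r v1 x * ?r v2 y)"
    unfolding gauss2_def gauss_half_minus[OF \<delta>]
    using G'.sigma_finite_measure_axioms gauss_half_minus[OF \<delta>, of v2]
    by (intro pair_measure_density) (auto simp: G.sigma_finite_measure_axioms)
  also have "(\<lambda>(x, y). ?r v1 x * ?r v2 y) = (\<lambda>w. ennreal (start_ratio v1 v2 \<delta> w))"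
  proof (rule ext, clarify)
    fix x y :: real
    have "?r v1 x * ?r v2 y = ennreal ((1 / sqrt (1 - 2 * \<delta>) * (1 / sqrt (1 - 2 * \<delta>))) *
        (exp (- x\<^sup>2 * (2 * \<delta> / (1 - 2 * \<delta>)) + v1\<^sup>2 * \<delta> / 2) * exp (- y\<^sup>2 * (2 * \<delta> / (1 - 2 * \<delta>)) + v2\<^sup>2 * \<delta> / 2)))"
      using \<delta> by (subst ennreal_mult[symmetric]) (auto simp: ac_simps)
    also have "1 / sqrt (1 - 2 * \<delta>) * (1 / sqrt (1 - 2 * \<delta>)) = 1 / (1 - 2 * \<delta>)"
      using \<delta> by simp
    also have "exp (- x\<^sup>2 * (2 * \<delta> / (1 - 2 * \<delta>)) + v1\<^sup>2 * \<delta> / 2) * exp (- y\<^sup>2 * (2 * \<delta> / (1 - 2 * \<delta>)) + v2\<^sup>2 * \<delta> / 2)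
       = exp (- (x\<^sup>2 + y\<^sup>2) * (2 * \<delta> / (1 - 2 * \<delta>)) + (v1\<^sup>2 + v2\<^sup>2) * \<delta> / 2)"
      by (simp only: exp_add[symmetric]) (simp add: algebra_simps add_divide_distrib diff_divide_distrib)
    finally show "?r v1 x * ?r v2 y = ennreal (start_ratio v1 v2 \<delta> (x, y))"
      by (simp add: start_ratio_def)
  qed
  finally show ?thesis
    using F by (simp add: nn_integral_density measurable_cong_sets[OF sets_gauss2 refl])
qed

lemma inverse_square_tendsto_0: "((\<lambda>u::real. x / u\<^sup>2) \<longlongrightarrow> 0) at_top"
  by (intro real_tendsto_divide_at_top[OF tendsto_const] filterlim_pow_at_top filterlim_ident) simp

text \<open>Since \<delta> u^2 = x, the density ratio is a function of \<open>w / u\<close> and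
  \<delta> alone. It is continuous at the limit point, and its modulus of continuity there yields
  \<eta>.\<close>

lemma start_ratio_on_bulk:
  assumes "0 < \<zeta>"
  obtains \<eta> where "0 < \<eta>" "\<forall>\<^sub>F u in at_top. \<forall>w\<in>bulk d \<eta> u.
    \<bar>start_ratio v1 v2 (x / u\<^sup>2) w - exp (- ((1 + d\<^sup>2) * x / 2))\<bar> \<le> \<zeta>"
proof -
  define g where "g t = (case t of (p, r, \<delta>) \<Rightarrow> 1 / (1 - 2 * \<delta>) *
      exp (- (p\<^sup>2 + r\<^sup>2) * (2 * x / (1 - 2 * \<delta>)) + (v1\<^sup>2 + v2\<^sup>2) * \<delta> / 2))" for t :: "real \<times> real \<times> real"
  have "isCont g (1/2, d/2, 0)"
    unfolding g_def split_beta by (intro continuous_intros) auto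
  then obtain e where e: "0 < e" "\<And>t. dist t (1/2, d/2, 0) < e \<Longrightarrow> dist (g t) (g (1/2, d/2, 0)) < \<zeta>"
    using \<open>0 < \<zeta>\<close> unfolding continuous_at_eps_delta by metis
  \<comment> \<open>At this point p^2 + r^2 = (1 + d^2)/4, and the factor 2 x produces the exponent
    of the limit.\<close>
  have g0: "g (1/2, d/2, 0) = exp (- ((1 + d\<^sup>2) * x / 2))"
    by (simp add: g_def power_divide field_simps)
  from tendstoD[OF inverse_square_tendsto_0, of "e/4" x] have "\<forall>\<^sub>F u in at_top. \<bar>x / u\<^sup>2\<bar> < e / 4" using e by (simp add: dist_real_def)
  then have "\<forall>\<^sub>F u in at_top. \<forall>w\<in>bulk d (e/4) u.
    \<bar>start_ratio v1 v2 (x / u\<^sup>2) w - exp (- ((1 + d\<^sup>2) * x / 2))\<bar> \<le> \<zeta>"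
    using eventually_gt_at_top[of 0]
  proof eventually_elim
    case (elim u)
    show ?case
    proof
      fix w assume "w \<in> bulk d (e/4) u"
      then have b: "\<bar>fst w - u / 2\<bar> \<le> e / 4 * u" "\<bar>snd w - d * u / 2\<bar> \<le> e / 4 * u" by (auto simp: bulk_def)
      have "fst w / u - 1 / 2 = (fst w - u / 2) / u" "snd w / u - d / 2 = (snd w - d * u / 2) / u"
        using elim by (auto simp: field_simps)
      then have "\<bar>fst w / u - 1 / 2\<bar> = \<bar>fst w - u / 2\<bar> / u" "\<bar>snd w / u - d / 2\<bar> = \<bar>snd w - d * u / 2\<bar> / u"
        using elim by (auto simp: abs_divide)
      then have b': "\<bar>fst w / u - 1 / 2\<bar> \<le> e / 4" "\<bar>snd w / u - d / 2\<bar> \<le> e / 4"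
        using b elim by (auto simp: pos_divide_le_eq)
      let ?t = "(fst w / u, snd w / u, x / u\<^sup>2)"
      have "dist ?t (1/2, d/2, 0) \<le> dist (fst w / u) (1/2) + dist (snd w / u, x / u\<^sup>2) (d/2, 0)"
        unfolding dist_Pair_Pair by (intro sqrt_sum_squares_le_sum) auto
      also have "\<dots> \<le> dist (fst w / u) (1/2) + (dist (snd w / u) (d/2) + dist (x / u\<^sup>2) 0)"
        unfolding dist_Pair_Pair by (intro add_left_mono sqrt_sum_squares_le_sum) auto
      also have "\<dots> < e"
        using b' elim(1) unfolding dist_real_def diff_0_right by linarith
      finally have "dist (g ?t) (g (1/2, d/2, 0)) < \<zeta>" by (rule e)
      moreover have "g ?t = start_ratio v1 v2 (x / u\<^sup>2) w"
        using elim unfolding g_def start_ratio_def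
        by (simp add: power_divide add_divide_distrib[symmetric] field_simps)
      ultimately show "\<bar>start_ratio v1 v2 (x / u\<^sup>2) w - exp (- ((1 + d\<^sup>2) * x / 2))\<bar> \<le> \<zeta>"
        by (simp add: g0 dist_real_def)
    qed
  qed
  with e show ?thesis by (intro that[of "e/4"]) auto
qed

lemma inverse_square_small:
  fixes x e :: real
  assumes "0 < e"
  shows "\<forall>\<^sub>F u in at_top. x / u\<^sup>2 < e"
  by (rule order_tendstoD(2)[OF inverse_square_tendsto_0 assms])

text \<open>The factor containing \<open>w\<close> is at most 1, because the earlier law is the
  narrower one. The remaining prefactor tends to 1, so any constant above 1 would serve; uniformity
  in \<open>w\<close> is what the region outside the bulk requires.\<close>

lemma start_ratio_le_2:
  assumes "0 \<le> x"
  shows "\<forall>\<^sub>F u in at_top. \<forall>w. start_ratio v1 v2 (x / u\<^sup>2) w \<le> 2"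
proof -
  have "((\<lambda>u. 1 / (1 - 2 * (x / u\<^sup>2)) * exp ((v1\<^sup>2 + v2\<^sup>2) * (x / u\<^sup>2) / 2)) \<longlongrightarrow>
      1 / (1 - 2 * 0) * exp ((v1\<^sup>2 + v2\<^sup>2) * 0 / 2)) at_top"
    by (intro tendsto_intros inverse_square_tendsto_0) auto
  then have "\<forall>\<^sub>F u in at_top. 1 / (1 - 2 * (x / u\<^sup>2)) * exp ((v1\<^sup>2 + v2\<^sup>2) * (x / u\<^sup>2) / 2) < 2"
    by (rule order_tendstoD(2)) simp
  then show ?thesis using inverse_square_small[OF half_gt_zero[OF zero_less_one], of x]
  proof eventually_elim
    case (elim u)
    show ?case
    proof
      fix w
      have "0 \<le> x / u\<^sup>2" "0 \<le> 1 - 2 * (x / u\<^sup>2)"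
        using assms elim(2) by (auto simp only: divide_nonneg_nonneg zero_le_power2)
      then have "0 \<le> ((fst w)\<^sup>2 + (snd w)\<^sup>2) * (2 * (x / u\<^sup>2) / (1 - 2 * (x / u\<^sup>2)))"
        using assms by (intro mult_nonneg_nonneg divide_nonneg_nonneg sum_power2_ge_zero) auto
      moreover have "- p * r + z \<le> z" if "0 \<le> p * r" for p r z :: real
        using that by simp
      ultimately have "start_ratio v1 v2 (x / u\<^sup>2) w \<le> 1 / (1 - 2 * (x / u\<^sup>2)) * exp ((v1\<^sup>2 + v2\<^sup>2) * (x / u\<^sup>2) / 2)"
        unfolding start_ratio_def using \<open>0 \<le> 1 - 2 * (x / u\<^sup>2)\<close>
        by (intro mult_left_mono iffD2[OF exp_le_cancel_iff] divide_nonneg_nonneg) (blast | simp)+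
      then show "start_ratio v1 v2 (x / u\<^sup>2) w \<le> 2" using elim by simp
    qed
  qed
qed

lemma exp_neg_square_small:
  fixes c K e :: real
  assumes "0 < c" "0 < e"
  shows "\<forall>\<^sub>F u in at_top. exp (- (c * u\<^sup>2) + K * u) < e"
proof -
  have "LIM u at_top. u * (- K + c * u) :> at_top"
    using assms by (intro filterlim_at_top_mult_at_top filterlim_ident
       filterlim_tendsto_add_at_top[OF tendsto_const] filterlim_tendsto_pos_mult_at_top[OF tendsto_const])
  then have "((\<lambda>u. exp (- (u * (- K + c * u)))) \<longlongrightarrow> 0) at_top"
    by (intro filterlim_compose[OF exp_at_bot] filterlim_compose[OF filterlim_uminus_at_bot_at_top])
  from order_tendstoD(2)[OF this \<open>0 < e\<close>] show ?thesis
    by (simp add: algebra_simps power2_eq_square)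
qed

section \<open>Comparison of the two windows, uniformly in the grid\<close>

text \<open>The starting point is split at the edge of the bulk: inside, the density ratio is within
  \<zeta> of \<open>L\<close>; outside, it is at most 2 and the mass is negligible. The choice of
  \<open>u\<close> precedes that of \<open>k\<close> and \<open>h\<close>, so grids can be refined
  at fixed \<open>u\<close>. The yardstick \<open>low\<close> does not depend on the grid.\<close>

lemma hit_probability_asymptotics:
  fixes a \<rho> x \<zeta> v1 v2 :: real
  assumes \<rho>: "a \<le> 1" "-1 < \<rho>" "\<rho> < 1" and "0 \<le> x" "0 < \<zeta>"
  defines "low \<equiv> \<lambda>u. emeasure (gauss2 v1 v2 1) (ruin_set a \<rho> u)"
    and "I \<equiv> \<lambda>u k h t. \<integral>\<^sup>+w. hit (ruin_set a \<rho> u) (gauss2 v1 v2 h) k w \<partial>gauss2 v1 v2 t"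
    and "L \<equiv> exp (- (q_const a \<rho> * x / 2))"
  shows "\<forall>\<^sub>F u in at_top. \<forall>k h. 0 < h \<longrightarrow>
      (\<forall>t>0. t + real k * h = 1 / 2 \<longrightarrow> I u k h t \<le> ennreal \<zeta> * low u) \<and>
      (real k * h = 1 / 2 \<longrightarrow>
        I u k h (1 / 2 - x / u\<^sup>2) \<le> ennreal (L + \<zeta>) * I u k h (1 / 2) + ennreal \<zeta> * low u \<and>
        ennreal (L - \<zeta>) * I u k h (1 / 2) \<le> I u k h (1 / 2 - x / u\<^sup>2) + ennreal \<zeta> * low u)"
proof -
  define d where "d = corner a \<rho>"
  define q where "q = q_const a \<rho>"
  have q: "q = 1 + d\<^sup>2" unfolding q_def d_def by (rule q_const_eq[OF \<rho>(2,3)])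
  then have q1: "0 < q" by (simp add: add_pos_nonneg)
  obtain C K where C: "0 < C" and lower: "\<And>u. 0 < u \<Longrightarrow> ennreal (C * exp (- (q * u\<^sup>2 / 2) - K * u)) \<le> low u"
    using ruin_set_lower[OF \<rho>(2,3), of a v1 v2] unfolding low_def q_def by blast
  obtain \<eta> where \<eta>: "0 < \<eta>" and ratio: "\<forall>\<^sub>F u in at_top. \<forall>w\<in>bulk d \<eta> u.
      \<bar>start_ratio v1 v2 (x / u\<^sup>2) w - L\<bar> \<le> \<zeta>"
    using start_ratio_on_bulk[OF \<open>0 < \<zeta>\<close>, of d v1 v2 x] unfolding L_def q_def[symmetric] q by blast
  define K1 where "K1 = (1 + \<eta>) * (\<bar>v1\<bar> + d * \<bar>v2\<bar> + \<bar>v2\<bar>)"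
  define K2 where "K2 = (\<bar>v1\<bar> + d * \<bar>v2\<bar>) / 2"
  \<comment> \<open>The 8 is the bound 2 on \<open>start_ratio\<close> times the four half planes.
    The \<open>q / 4\<close> is the gap between the exponents 3q/4 (ruin up to time 1/2) and q/2
    (ruin at time 1). Adding \<open>K\<close> below pays for the linear loss in
    \<open>low\<close>.\<close>
  have "0 < 3 / 4 * \<eta>\<^sup>2" "0 < \<zeta> * C / 8" "0 < q / 4" "0 < \<zeta> * C" using \<eta> C q1 \<open>0 < \<zeta>\<close> by auto
  note small1 = exp_neg_square_small[OF this(1,2), of "K1 + K"]
    and small2 = exp_neg_square_small[OF this(3,4), of "K2 + K"]
  have scale: "ennreal r \<le> ennreal \<zeta> * low u" if "0 < u" "r \<le> \<zeta> * (C * exp (- (q * u\<^sup>2 / 2) - K * u))" for r u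
  proof -
    have "ennreal r \<le> ennreal \<zeta> * ennreal (C * exp (- (q * u\<^sup>2 / 2) - K * u))"
      using that \<open>0 < \<zeta>\<close> by (subst ennreal_mult'[symmetric]) (auto intro: ennreal_leI)
    also have "\<dots> \<le> ennreal \<zeta> * low u" using lower[OF that(1)] by (rule mult_left_mono) simp
    finally show ?thesis .
  qed
  show ?thesis
    using ratio start_ratio_le_2[OF \<open>0 \<le> x\<close>, of v1 v2] small1 small2
      inverse_square_small[OF half_gt_zero[OF zero_less_one], of x] eventually_gt_at_top[of 0]
  proof eventually_elim
    case (elim u)
    note u = elim(6)
    have \<delta>: "0 \<le> x / u\<^sup>2" "x / u\<^sup>2 < 1 / 2" using \<open>0 \<le> x\<close> elim by auto
    show ?case
    proof (intro allI impI conjI)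
      fix k :: nat and h t :: real assume "0 < h" "0 < t" "t + real k * h = 1 / 2"
      have "I u k h t \<le> ennreal (exp (- q * u\<^sup>2 + 1 / 2 * (u\<^sup>2 * q / 2 + u * (\<bar>v1\<bar> + d * \<bar>v2\<bar>))))"
        using hit_probability_upper[OF \<rho> u \<open>0 < h\<close> \<open>0 < t\<close>, of v1 v2 k] \<open>t + real k * h = 1 / 2\<close>
        by (simp add: I_def q_def d_def)
      also have "\<dots> \<le> ennreal \<zeta> * low u"
      proof (rule scale[OF u])
        have "exp (- q * u\<^sup>2 + 1 / 2 * (u\<^sup>2 * q / 2 + u * (\<bar>v1\<bar> + d * \<bar>v2\<bar>)))
          = exp (- (q / 4 * u\<^sup>2) + (K2 + K) * u) * exp (- (q * u\<^sup>2 / 2) - K * u)"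
          unfolding exp_add[symmetric] K2_def by (simp add: field_simps)
        also have "\<dots> \<le> (\<zeta> * C) * exp (- (q * u\<^sup>2 / 2) - K * u)"
          using elim(4) by (intro mult_right_mono) auto
        finally show "exp (- q * u\<^sup>2 + 1 / 2 * (u\<^sup>2 * q / 2 + u * (\<bar>v1\<bar> + d * \<bar>v2\<bar>))) \<le>
            \<zeta> * (C * exp (- (q * u\<^sup>2 / 2) - K * u))" by (simp add: mult.assoc)
      qed
      finally show "I u k h t \<le> ennreal \<zeta> * low u" .
    next
      fix k :: nat and h :: real assume h: "0 < h" "real k * h = 1 / 2"
      let ?G = "gauss2 v1 v2 (1/2)"
      let ?H = "hit (ruin_set a \<rho> u) (gauss2 v1 v2 h) k"
      let ?B = "indicator (- bulk d \<eta> u) :: _ \<Rightarrow> ennreal"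
      interpret Gh: prob_space "gauss2 v1 v2 h" using h by (intro prob_space_gauss2)
      have Hm: "?H \<in> borel_measurable borel"
        by (intro hit_measurable Gh.sigma_finite_measure_axioms) auto
      note [measurable] = Hm
      have [measurable]: "?H \<in> borel_measurable ?G"
        using Hm by (simp add: measurable_cong_sets[OF sets_gauss2 refl])
      have I2: "I u k h (1 / 2 - x / u\<^sup>2) = (\<integral>\<^sup>+w. ennreal (start_ratio v1 v2 (x / u\<^sup>2) w) * ?H w \<partial>?G)"
        unfolding I_def by (rule nn_integral_gauss2_half_minus[OF \<delta> Hm])
      have "(\<integral>\<^sup>+w. ?H w * ?B w \<partial>?G) \<le> ennreal (4 * exp (- (q * u\<^sup>2 / 2) - 3 / 4 * \<eta>\<^sup>2 * u\<^sup>2 + K1 * u))"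
        unfolding K1_def q_def d_def by (rule hit_outside_bulk[OF \<rho> u h(1) \<eta> h(2)])
      moreover have "2 * (4 * exp (- (q * u\<^sup>2 / 2) - 3 / 4 * \<eta>\<^sup>2 * u\<^sup>2 + K1 * u)) \<le> \<zeta> * (C * exp (- (q * u\<^sup>2 / 2) - K * u))"
      proof -
        have "exp (- (q * u\<^sup>2 / 2) - 3 / 4 * \<eta>\<^sup>2 * u\<^sup>2 + K1 * u)
          = exp (- (3 / 4 * \<eta>\<^sup>2 * u\<^sup>2) + (K1 + K) * u) * exp (- (q * u\<^sup>2 / 2) - K * u)"
          unfolding exp_add[symmetric] by (simp add: algebra_simps)
        also have "\<dots> \<le> \<zeta> * C / 8 * exp (- (q * u\<^sup>2 / 2) - K * u)"
          using elim(3) by (intro mult_right_mono) auto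
        finally show ?thesis by simp
      qed
      ultimately have bad2: "2 * (\<integral>\<^sup>+w. ?H w * ?B w \<partial>?G) \<le> ennreal \<zeta> * low u"
      proof -
        assume b: "(\<integral>\<^sup>+w. ?H w * ?B w \<partial>?G) \<le> ennreal (4 * exp (- (q * u\<^sup>2 / 2) - 3 / 4 * \<eta>\<^sup>2 * u\<^sup>2 + K1 * u))"
          and r: "2 * (4 * exp (- (q * u\<^sup>2 / 2) - 3 / 4 * \<eta>\<^sup>2 * u\<^sup>2 + K1 * u)) \<le> \<zeta> * (C * exp (- (q * u\<^sup>2 / 2) - K * u))"
        have "2 * (\<integral>\<^sup>+w. ?H w * ?B w \<partial>?G) \<le> ennreal 2 * ennreal (4 * exp (- (q * u\<^sup>2 / 2) - 3 / 4 * \<eta>\<^sup>2 * u\<^sup>2 + K1 * u))"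
          using b by (simp add: mult_left_mono)
        also have "\<dots> = ennreal (2 * (4 * exp (- (q * u\<^sup>2 / 2) - 3 / 4 * \<eta>\<^sup>2 * u\<^sup>2 + K1 * u)))"
          by (subst ennreal_mult') auto
        also have "\<dots> \<le> ennreal \<zeta> * low u" using u r by (rule scale)
        finally show ?thesis .
      qed
      have nn: "0 \<le> start_ratio v1 v2 (x / u\<^sup>2) w" for w using \<delta> by (intro start_ratio_nonneg)
      have "I u k h (1 / 2 - x / u\<^sup>2) \<le> (\<integral>\<^sup>+w. ennreal (L + \<zeta>) * ?H w + 2 * (?H w * ?B w) \<partial>?G)"
        unfolding I2
      proof (intro nn_integral_mono)
        fix w
        show "ennreal (start_ratio v1 v2 (x / u\<^sup>2) w) * ?H w \<le> ennreal (L + \<zeta>) * ?H w + 2 * (?H w * ?B w)"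
        proof (cases "w \<in> bulk d \<eta> u")
          case True
          then have "start_ratio v1 v2 (x / u\<^sup>2) w \<le> L + \<zeta>" using elim(1) by (auto simp: abs_le_iff)
          then have "ennreal (start_ratio v1 v2 (x / u\<^sup>2) w) * ?H w \<le> ennreal (L + \<zeta>) * ?H w"
            by (intro mult_right_mono ennreal_leI) simp_all
          then show ?thesis by (intro add_increasing2) simp_all
        next
          case False
          have "ennreal (start_ratio v1 v2 (x / u\<^sup>2) w) \<le> ennreal 2" using elim(2)[rule_format, of w] by (rule ennreal_leI)
          then have "ennreal (start_ratio v1 v2 (x / u\<^sup>2) w) * ?H w \<le> 2 * ?H w" by (intro mult_right_mono) auto
          then show ?thesis using False by (intro add_increasing) auto
        qed
      qed
      also have "\<dots> = ennreal (L + \<zeta>) * I u k h (1/2) + 2 * (\<integral>\<^sup>+w. ?H w * ?B w \<partial>?G)"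
        unfolding I_def by (subst nn_integral_add) (auto simp: nn_integral_cmult)
      also have "\<dots> \<le> ennreal (L + \<zeta>) * I u k h (1/2) + ennreal \<zeta> * low u"
        by (intro add_left_mono bad2)
      finally show "I u k h (1 / 2 - x / u\<^sup>2) \<le> ennreal (L + \<zeta>) * I u k h (1 / 2) + ennreal \<zeta> * low u" .
      have "ennreal (L - \<zeta>) * I u k h (1/2) = (\<integral>\<^sup>+w. ennreal (L - \<zeta>) * ?H w \<partial>?G)"
        unfolding I_def by (subst nn_integral_cmult) auto
      also have "\<dots> \<le> (\<integral>\<^sup>+w. ennreal (start_ratio v1 v2 (x / u\<^sup>2) w) * ?H w + 2 * (?H w * ?B w) \<partial>?G)"
      proof (intro nn_integral_mono)
        fix w
        show "ennreal (L - \<zeta>) * ?H w \<le> ennreal (start_ratio v1 v2 (x / u\<^sup>2) w) * ?H w + 2 * (?H w * ?B w)"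
        proof (cases "w \<in> bulk d \<eta> u")
          case True
          then have "L - \<zeta> \<le> start_ratio v1 v2 (x / u\<^sup>2) w" using elim(1) by (auto simp: abs_le_iff)
          then show ?thesis by (intro add_increasing2 mult_right_mono ennreal_leI) auto
        next
          case False
          \<comment> \<open>Off the bulk the density ratio is discarded, and the error term alone
            dominates the left side. A negative \<open>L - \<zeta>\<close> counts as 0 in
            \<open>ennreal\<close>.\<close>
          have "L \<le> 1" using \<open>0 \<le> x\<close> q1 by (simp add: L_def q_def)
          then have "ennreal (L - \<zeta>) \<le> ennreal 2" using \<open>0 < \<zeta>\<close> by (intro ennreal_leI) auto
          then have "ennreal (L - \<zeta>) * ?H w \<le> 2 * ?H w" by (intro mult_right_mono) auto
          then show ?thesis using False by (intro add_increasing) auto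
        qed
      qed
      also have "\<dots> = I u k h (1 / 2 - x / u\<^sup>2) + 2 * (\<integral>\<^sup>+w. ?H w * ?B w \<partial>?G)"
        unfolding I2 by (subst nn_integral_add) (auto simp: nn_integral_cmult)
      also have "\<dots> \<le> I u k h (1 / 2 - x / u\<^sup>2) + ennreal \<zeta> * low u"
        by (intro add_left_mono bad2)
      finally show "ennreal (L - \<zeta>) * I u k h (1 / 2) \<le> I u k h (1 / 2 - x / u\<^sup>2) + ennreal \<zeta> * low u" .
    qed
  qed
qed

section \<open>From the continuous time event to grids\<close>

definition ruin_at :: "(real \<Rightarrow> 'a \<Rightarrow> real) \<Rightarrow> (real \<Rightarrow> 'a \<Rightarrow> real) \<Rightarrow> real \<Rightarrow> real \<Rightarrow> real \<Rightarrow> real \<Rightarrow> 'a \<Rightarrow> real \<Rightarrow> bool" where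
  "ruin_at W1 W2 c1 c2 a u \<omega> t \<longleftrightarrow> W1 t \<omega> - c1 * t > u \<and> W2 t \<omega> - c2 * t > a * u"

text \<open>Dyadic points of a window of length 1/2. Level \<open>n\<close> takes
  \<open>2 ^ n\<close> steps of size \<open>1 / 2 ^ Suc n\<close>, so its walk lasts exactly 1/2;
  the levels are nested, as continuity from below requires.\<close>

definition grid :: "real \<Rightarrow> real set" where
  "grid \<alpha> = (\<Union>n. (\<lambda>j. \<alpha> + real j * (1 / 2 ^ Suc n)) ` {..2 ^ n})"

lemma tau_sim_le_1_iff:
  "tau_sim W1 W2 c1 c2 a u \<omega> \<le> 1 \<longleftrightarrow> (\<exists>t\<in>{0..1}. ruin_at W1 W2 c1 c2 a u \<omega> t)"
proof -
  let ?T = "{t \<in> {0..1}. ruin_at W1 W2 c1 c2 a u \<omega> t}"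
  have tau: "tau_sim W1 W2 c1 c2 a u \<omega> = Inf (ereal ` ?T)"
    by (simp add: tau_sim_def ruin_at_def)
  show ?thesis
  proof
    assume "tau_sim W1 W2 c1 c2 a u \<omega> \<le> 1"
    then have "ereal ` ?T \<noteq> {}" unfolding tau by (metis Inf_empty top_ereal_def ereal_infty_less_eq(1) PInfty_neq_ereal(2) one_ereal_def)
    then show "\<exists>t\<in>{0..1}. ruin_at W1 W2 c1 c2 a u \<omega> t" by auto
  next
    assume "\<exists>t\<in>{0..1}. ruin_at W1 W2 c1 c2 a u \<omega> t"
    then obtain t where "t \<in> ?T" by auto
    then have "Inf (ereal ` ?T) \<le> ereal t" "ereal t \<le> 1" by (auto intro: Inf_lower)
    then show "tau_sim W1 W2 c1 c2 a u \<omega> \<le> 1" unfolding tau by (rule order_trans)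
  qed
qed

text \<open>The first condition says that the infimum is at least \<open>1 - x / u\<^sup>2\<close>,
  that is, that no ruin time is smaller; hence the half-open interval and an exact pathwise
  statement. Without ruin \<open>tau_sim\<close> is \<infinity> and the first condition holds
  vacuously, so the conjunct \<open>\<le> 1\<close> matters.\<close>

lemma tau_sim_late_iff:
  assumes "0 < u" "0 \<le> x"
  shows "ereal (u\<^sup>2) * (1 - tau_sim W1 W2 c1 c2 a u \<omega>) \<le> ereal x \<and> tau_sim W1 W2 c1 c2 a u \<omega> \<le> 1 \<longleftrightarrow>
    (\<exists>t\<in>{0..1}. ruin_at W1 W2 c1 c2 a u \<omega> t) \<and> \<not> (\<exists>t\<in>{0..<1 - x / u\<^sup>2}. ruin_at W1 W2 c1 c2 a u \<omega> t)"
proof (cases "tau_sim W1 W2 c1 c2 a u \<omega> \<le> 1")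
  case True
  let ?T = "{t \<in> {0..1}. ruin_at W1 W2 c1 c2 a u \<omega> t}"
  have tau: "tau_sim W1 W2 c1 c2 a u \<omega> = Inf (ereal ` ?T)"
    by (simp add: tau_sim_def ruin_at_def)
  have "0 \<le> tau_sim W1 W2 c1 c2 a u \<omega>" unfolding tau by (intro Inf_greatest) auto
  then obtain r where r: "tau_sim W1 W2 c1 c2 a u \<omega> = ereal r"
    using True by (cases "tau_sim W1 W2 c1 c2 a u \<omega>") auto
  have "ereal (u\<^sup>2) * (1 - tau_sim W1 W2 c1 c2 a u \<omega>) \<le> ereal x \<longleftrightarrow> ereal (1 - x / u\<^sup>2) \<le> tau_sim W1 W2 c1 c2 a u \<omega>"
    unfolding r one_ereal_def using assms by (simp add: field_simps)
  also have "\<dots> \<longleftrightarrow> (\<forall>t\<in>?T. 1 - x / u\<^sup>2 \<le> t)"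
    unfolding tau le_Inf_iff by auto
  also have "\<dots> \<longleftrightarrow> \<not> (\<exists>t\<in>{0..<1 - x / u\<^sup>2}. ruin_at W1 W2 c1 c2 a u \<omega> t)"
  proof -
    have "1 - x / u\<^sup>2 \<le> 1" using assms by simp
    then show ?thesis by force
  qed
  finally show ?thesis using True tau_sim_le_1_iff[of W1 W2 c1 c2 a u \<omega>] by blast
next
  case False
  then show ?thesis using tau_sim_le_1_iff[of W1 W2 c1 c2 a u \<omega>] by blast
qed

section \<open>Dyadic grids and continuity of paths\<close>

lemma grid_bounds: "t \<in> grid \<alpha> \<Longrightarrow> \<alpha> \<le> t \<and> t \<le> \<alpha> + 1 / 2"
proof -
  assume "t \<in> grid \<alpha>"
  then obtain n j where t: "t = \<alpha> + real j * (1 / 2 ^ Suc n)" and j: "j \<le> 2 ^ n" by (auto simp: grid_def)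
  have "real j \<le> 2 ^ n" using j by (metis of_nat_le_iff of_nat_numeral of_nat_power)
  then show ?thesis by (simp add: t field_simps)
qed

lemma countable_grid: "countable (grid \<alpha>)"
  by (auto simp: grid_def)

text \<open>Rounding up on a fine level. The strict \<open>\<alpha> < s\<close> allows the grid from
  0 to omit time 0, where there is no Gaussian starting law.\<close>

lemma grid_dense:
  assumes t: "\<alpha> \<le> t" "t \<le> \<alpha> + 1 / 2" and "0 < e"
  obtains s where "s \<in> grid \<alpha>" "\<bar>s - t\<bar> < e" "\<alpha> < s"
proof -
  obtain n where n: "(1 / 2 :: real) ^ n < e" using real_arch_pow_inv[OF \<open>0 < e\<close>, of "1/2"] by auto
  define h :: real where "h = 1 / 2 ^ Suc n"
  have h: "0 < h" "h < e" using n by (auto simp: h_def power_divide field_simps)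
  define y where "y = (t - \<alpha>) / h"
  have "y \<le> (1 / 2) / h" unfolding y_def using t h by (intro divide_right_mono) auto
  then have y: "0 \<le> y" "y \<le> 2 ^ n" "t = \<alpha> + y * h" using t h by (auto simp: y_def h_def)
  \<comment> \<open>The maximum with 1 matters only for \<open>y = 0\<close>, that is
    \<open>t = \<alpha>\<close>, which is moved to the next grid point.\<close>
  define j where "j = max 1 (nat \<lceil>y\<rceil>)"
  have "\<lceil>y\<rceil> \<le> 2 ^ n" using y(2) by (simp add: ceiling_le_iff)
  then have "nat \<lceil>y\<rceil> \<le> 2 ^ n" by (simp add: nat_le_iff)
  then have j: "j \<le> 2 ^ n" "1 \<le> j" by (auto simp: j_def)
  have "y \<le> real j \<and> real j \<le> y + 1"
  proof (cases "y = 0")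
    case False
    then have "0 < y" using y by simp
    then have "real (nat \<lceil>y\<rceil>) = of_int \<lceil>y\<rceil>" "1 \<le> nat \<lceil>y\<rceil>" by (auto simp: le_nat_iff)
    then show ?thesis using ceiling_correct[of y] by (auto simp: j_def max_def)
  qed (simp add: j_def)
  then have "0 \<le> (real j - y) * h" "(real j - y) * h \<le> 1 * h" using h by (auto intro!: mult_right_mono mult_nonneg_nonneg)
  then have "\<bar>(\<alpha> + real j * h) - t\<bar> < e" using h y by (simp add: algebra_simps)
  moreover have "\<alpha> + real j * h \<in> grid \<alpha>" using j by (auto simp: grid_def h_def)
  moreover have "\<alpha> < \<alpha> + real j * h" using j h by simp
  ultimately show ?thesis using that by blast
qed

lemma ruin_at_open:
  assumes W: "continuous_on {0..} (\<lambda>t. W1 t \<omega>)" "continuous_on {0..} (\<lambda>t. W2 t \<omega>)"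
    and t: "0 \<le> t" "ruin_at W1 W2 c1 c2 a u \<omega> t"
  obtains e where "0 < e" "\<And>s. 0 \<le> s \<Longrightarrow> \<bar>s - t\<bar> < e \<Longrightarrow> ruin_at W1 W2 c1 c2 a u \<omega> s"
proof -
  define g where "g t = min (W1 t \<omega> - c1 * t - u) (W2 t \<omega> - c2 * t - a * u)" for t
  have g: "ruin_at W1 W2 c1 c2 a u \<omega> t \<longleftrightarrow> 0 < g t" for t
    by (auto simp: g_def ruin_at_def)
  have "continuous_on {0..} g" unfolding g_def by (intro continuous_intros W)
  then obtain e where "0 < e" "\<And>s. 0 \<le> s \<Longrightarrow> dist s t < e \<Longrightarrow> dist (g s) (g t) < g t"
    using t unfolding continuous_on_iff g by (metis atLeast_iff)
  then have "ruin_at W1 W2 c1 c2 a u \<omega> s" if "0 \<le> s" "\<bar>s - t\<bar> < e" for s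
    using that unfolding g dist_real_def by fastforce
  with \<open>0 < e\<close> show ?thesis by (rule that)
qed

lemma (in prob_space) ruin_measurable:
  assumes W: "\<And>t. 0 \<le> t \<Longrightarrow> W1 t \<in> borel_measurable M" "\<And>t. 0 \<le> t \<Longrightarrow> W2 t \<in> borel_measurable M"
    and D: "countable D" "D \<subseteq> {0..}"
  shows "{\<omega> \<in> space M. \<exists>t\<in>D. ruin_at W1 W2 c1 c2 a u \<omega> t} \<in> sets M"
proof -
  have "{\<omega> \<in> space M. ruin_at W1 W2 c1 c2 a u \<omega> t} \<in> sets M" if "t \<in> D" for t
  proof -
    have [measurable]: "W1 t \<in> borel_measurable M" "W2 t \<in> borel_measurable M" using that D W by auto
    show ?thesis unfolding ruin_at_def by measurable
  qed
  then have "(\<Union>t\<in>D. {\<omega> \<in> space M. ruin_at W1 W2 c1 c2 a u \<omega> t}) \<in> sets M"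
    by (intro sets.countable_UN' D(1)) auto
  also have "(\<Union>t\<in>D. {\<omega> \<in> space M. ruin_at W1 W2 c1 c2 a u \<omega> t}) = {\<omega> \<in> space M. \<exists>t\<in>D. ruin_at W1 W2 c1 c2 a u \<omega> t}"
    by auto
  finally show ?thesis .
qed

text \<open>Ruin along countably many times is an event of the product sigma-algebra on paths, so
  equality of laws decides its probability. Ruin over an interval is in general not such an
  event.\<close>

lemma ruin_law_transfer:
  assumes "process_law N (\<lambda>t \<omega>. (W1 t \<omega>, W2 t \<omega>)) = process_law M (\<lambda>t \<omega>. (V1 t \<omega>, V2 t \<omega>))"
    and W: "\<And>t. 0 \<le> t \<Longrightarrow> W1 t \<in> borel_measurable N" "\<And>t. 0 \<le> t \<Longrightarrow> W2 t \<in> borel_measurable N"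
    and V: "\<And>t. 0 \<le> t \<Longrightarrow> V1 t \<in> borel_measurable M" "\<And>t. 0 \<le> t \<Longrightarrow> V2 t \<in> borel_measurable M"
    and D: "countable D" "D \<subseteq> {0..}"
  shows "emeasure N {\<omega> \<in> space N. \<exists>t\<in>D. ruin_at W1 W2 c1 c2 a u \<omega> t} =
    emeasure M {\<omega> \<in> space M. \<exists>t\<in>D. ruin_at V1 V2 c1 c2 a u \<omega> t}"
proof -
  let ?S = "\<Union>t\<in>D. {f \<in> space path_space. fst (f t) - c1 * t > u \<and> snd (f t) - c2 * t > a * u}"
  have "{f \<in> space path_space. fst (f t) - c1 * t > u \<and> snd (f t) - c2 * t > a * u} \<in> sets (path_space :: (real \<Rightarrow> real \<times> real) measure)"
    if "t \<in> D" for t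
  proof -
    have m: "(\<lambda>f. f t) \<in> measurable (path_space :: (real \<Rightarrow> real \<times> real) measure) borel"
      unfolding path_space_def by (rule measurable_component_singleton) (use that D in auto)
    then have [measurable]: "(\<lambda>f. f t) \<in> measurable (path_space :: (real \<Rightarrow> real \<times> real) measure) (borel \<Otimes>\<^sub>M borel)"
      by (simp only: borel_prod)
    show ?thesis by measurable
  qed
  then have S: "?S \<in> sets path_space" by (intro sets.countable_UN' D(1)) auto
  have *: "emeasure (process_law P (\<lambda>t \<omega>. (X1 t \<omega>, X2 t \<omega>))) ?S = emeasure P {\<omega> \<in> space P. \<exists>t\<in>D. ruin_at X1 X2 c1 c2 a u \<omega> t}"
    if X: "\<And>t. 0 \<le> t \<Longrightarrow> X1 t \<in> borel_measurable P" "\<And>t. 0 \<le> t \<Longrightarrow> X2 t \<in> borel_measurable P"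
    for P :: "'c measure" and X1 X2 :: "real \<Rightarrow> 'c \<Rightarrow> real"
  proof -
    have m: "sample_path (\<lambda>t \<omega>. (X1 t \<omega>, X2 t \<omega>)) \<in> measurable P path_space"
      unfolding path_space_def sample_path_def
      by (intro measurable_restrict) (use X in \<open>auto simp: borel_prod[symmetric]\<close>)
    have "sample_path (\<lambda>t \<omega>. (X1 t \<omega>, X2 t \<omega>)) \<omega> t = (X1 t \<omega>, X2 t \<omega>)" if "t \<in> D" for t \<omega>
      using that D by (auto simp: sample_path_def)
    then have "sample_path (\<lambda>t \<omega>. (X1 t \<omega>, X2 t \<omega>)) -` ?S \<inter> space P = {\<omega> \<in> space P. \<exists>t\<in>D. ruin_at X1 X2 c1 c2 a u \<omega> t}"
      using measurable_space[OF m] by (auto simp: ruin_at_def)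
    then show ?thesis
      unfolding process_law_def by (simp only: emeasure_distr[OF m S])
  qed
  show ?thesis using *[of W1 N W2, OF W] *[of V1 M V2, OF V] assms(1) by simp
qed

text \<open>Used with \<open>A\<close> an event about an interval of times and \<open>E\<close> its
  version over the rational times, which agree where paths are continuous.\<close>

lemma (in prob_space) measure_completion_AE_eq:
  assumes E: "E \<in> sets M" and A: "A \<subseteq> space M" and ae: "AE \<omega> in M. \<omega> \<in> A \<longleftrightarrow> \<omega> \<in> E"
  shows "A \<in> sets (completion M)" "measure (completion M) A = measure M E"
proof -
  have ae': "AE \<omega> in completion M. \<omega> \<in> E \<longleftrightarrow> \<omega> \<in> A"
    using AE_completion[OF ae] by eventually_elim auto
  show *: "A \<in> sets (completion M)"
    by (rule completion.in_sets_AE[OF ae']) (use E A in auto)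
  have "measure (completion M) A = measure (completion M) E"
    by (rule measure_eq_AE) (use ae' E * in auto)
  then show "measure (completion M) A = measure M E" using E by simp
qed

text \<open>Each grid level is a walk, and increasing limits over the levels preserve the walk
  estimates. In \<open>2 * \<zeta>\<close> one \<zeta> stems from the density ratio, the other from
  the error \<open>\<zeta> * low u\<close>, absorbed because time 1 belongs to
  \<open>grid (1 / 2)\<close>.\<close>

lemma grid_ruin_asymptotics:
  fixes M :: "'b measure" and B1 B2 :: "real \<Rightarrow> 'b \<Rightarrow> real"
    and N :: "'a measure" and W1 W2 :: "real \<Rightarrow> 'a \<Rightarrow> real"
    and c1 c2 a \<rho> x \<zeta> :: real
  assumes B1: "standard_brownian_motion M B1" and B2: "standard_brownian_motion M B2"
    and ind: "independent_processes M B1 B2"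
    and N: "prob_space N" and W1: "continuous_process N W1" and W2: "continuous_process N W2"
    and law: "process_law N (\<lambda>t \<omega>. (W1 t \<omega>, W2 t \<omega>)) =
         process_law M (\<lambda>t \<omega>. (B1 t \<omega>, \<rho> * B1 t \<omega> + sqrt (1 - \<rho>\<^sup>2) * B2 t \<omega>))"
    and \<rho>: "a \<le> 1" "-1 < \<rho>" "\<rho> < 1" and x: "0 \<le> x" and \<zeta>: "0 < \<zeta>"
  defines "p \<equiv> \<lambda>u D. measure N {\<omega> \<in> space N. \<exists>t\<in>D. ruin_at W1 W2 c1 c2 a u \<omega> t}"
    and "L \<equiv> exp (- (q_const a \<rho> * x / 2))"
  shows "\<forall>\<^sub>F u in at_top. 0 < p u (grid (1 / 2)) \<and> p u (grid 0 \<inter> {0<..}) \<le> \<zeta> * p u (grid (1 / 2)) \<and>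
     p u (grid (1 / 2 - x / u\<^sup>2)) \<le> (L + 2 * \<zeta>) * p u (grid (1 / 2)) \<and>
     (L - 2 * \<zeta>) * p u (grid (1 / 2)) \<le> p u (grid (1 / 2 - x / u\<^sup>2))"
proof -
  interpret N: prob_space N by fact
  define s where "s = sqrt (1 - \<rho>\<^sup>2)"
  have s: "0 < s" using one_minus_square_pos[OF \<rho>(2,3)] by (simp add: s_def)
  \<comment> \<open>The drift to be given to \<open>B2\<close> so that, with drift \<open>c1\<close>
    on \<open>B1\<close>, the correlated second component has drift \<open>c2\<close>.\<close>
  define v2 where "v2 = (c2 - \<rho> * c1) / s"
  have v2: "s * v2 = c2 - \<rho> * c1" using s by (simp add: v2_def)
  have Wm: "\<And>t. 0 \<le> t \<Longrightarrow> W1 t \<in> borel_measurable N" "\<And>t. 0 \<le> t \<Longrightarrow> W2 t \<in> borel_measurable N"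
    using W1 W2 by (auto simp: continuous_process_def)
  have Bm[measurable]: "\<And>t. 0 \<le> t \<Longrightarrow> B1 t \<in> borel_measurable M" "\<And>t. 0 \<le> t \<Longrightarrow> B2 t \<in> borel_measurable M"
    using B1 B2 by (auto simp: standard_brownian_motion_def continuous_process_def)
  define R where "R u D = {\<omega> \<in> space N. \<exists>t\<in>D. ruin_at W1 W2 c1 c2 a u \<omega> t}" for u D
  have Rm: "R u D \<in> sets N" if "countable D" "D \<subseteq> {0..}" for u D
    unfolding R_def by (rule N.ruin_measurable[OF Wm that])
  define I where "I u k h t = (\<integral>\<^sup>+w. hit (ruin_set a \<rho> u) (gauss2 c1 v2 h) k w \<partial>gauss2 c1 v2 t)" for u k h t
  define low where "low u = emeasure (gauss2 c1 v2 1) (ruin_set a \<rho> u)" for u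
  define F where "F n \<alpha> = (\<lambda>j. \<alpha> + real j * (1 / 2 ^ Suc n)) ` {..2 ^ n}" for n :: nat and \<alpha> :: real
  \<comment> \<open>The positive points of level \<open>n\<close> in \<open>[0, 1/2]\<close>. The
    walk starts one step in, at time \<open>1 / 2 ^ Suc n\<close>, so \<open>2 ^ n - 1\<close> steps
    lead to time 1/2.\<close>
  define F0 where "F0 n = (\<lambda>j. 1 / 2 ^ Suc n + real j * (1 / 2 ^ Suc n)) ` {..2 ^ n - 1}" for n :: nat
  have chain: "emeasure N (R u ((\<lambda>j. t + real j * h) ` {..k})) = I u k h t" if "0 < t" "0 < h" for u t h k
  proof -
    let ?D = "(\<lambda>j. t + real j * h) ` {..k}"
    have "emeasure N (R u ?D) = emeasure M {\<omega> \<in> space M. \<exists>t\<in>?D. ruin_at B1 (\<lambda>t \<omega>. \<rho> * B1 t \<omega> + s * B2 t \<omega>) c1 c2 a u \<omega> t}"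
      unfolding R_def s_def
      by (rule ruin_law_transfer[OF law Wm]) (use that in auto)
    also have "{\<omega> \<in> space M. \<exists>t\<in>?D. ruin_at B1 (\<lambda>t \<omega>. \<rho> * B1 t \<omega> + s * B2 t \<omega>) c1 c2 a u \<omega> t} =
       {\<omega> \<in> space M. \<exists>j\<le>k. (B1 (t + real j * h) \<omega> - c1 * (t + real j * h),
             B2 (t + real j * h) \<omega> - v2 * (t + real j * h)) \<in> ruin_set a \<rho> u}"
    proof -
      have "ruin_at B1 (\<lambda>t \<omega>. \<rho> * B1 t \<omega> + s * B2 t \<omega>) c1 c2 a u \<omega> t \<longleftrightarrow>
          (B1 t \<omega> - c1 * t, B2 t \<omega> - v2 * t) \<in> ruin_set a \<rho> u" for \<omega> t
      proof -
        have "\<rho> * (B1 t \<omega> - c1 * t) + s * (B2 t \<omega> - v2 * t) = \<rho> * B1 t \<omega> + s * B2 t \<omega> - (\<rho> * c1 + s * v2) * t"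
          by (simp add: algebra_simps)
        then show ?thesis by (simp add: ruin_at_def ruin_set_def s_def[symmetric] v2)
      qed
      then show ?thesis by auto
    qed
    also have "emeasure M \<dots> = I u k h t"
      unfolding I_def by (rule brownian_grid_hit_probability[OF B1 B2 ind that]) simp
    finally show ?thesis .
  qed
  have sup: "emeasure N (R u (\<Union>n. A n)) = (SUP n. emeasure N (R u (A n)))"
    if A: "\<And>n. countable (A n)" "\<And>n. A n \<subseteq> {0..}" "\<And>n. A n \<subseteq> A (Suc n)" for u and A :: "nat \<Rightarrow> real set"
  proof -
    have "range (\<lambda>n. R u (A n)) \<subseteq> sets N" using Rm A by auto
    moreover have "incseq (\<lambda>n. R u (A n))" using A(3) by (intro incseq_SucI) (auto simp: R_def)
    ultimately have "(SUP n. emeasure N (R u (A n))) = emeasure N (\<Union>n. R u (A n))"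
      by (rule SUP_emeasure_incseq)
    also have "(\<Union>n. R u (A n)) = R u (\<Union>n. A n)" by (auto simp: R_def)
    finally show ?thesis ..
  qed
  have gridF: "grid \<alpha> = (\<Union>n. F n \<alpha>)" for \<alpha> by (simp add: grid_def F_def)
  have F_mono: "F n \<alpha> \<subseteq> F (Suc n) \<alpha>" for n \<alpha>
  proof
    fix t assume "t \<in> F n \<alpha>"
    then obtain j where j: "j \<le> 2 ^ n" "t = \<alpha> + real j * (1 / 2 ^ Suc n)" by (auto simp: F_def)
    then have "2 * j \<le> 2 ^ Suc n" "t = \<alpha> + real (2 * j) * (1 / 2 ^ Suc (Suc n))" by auto
    then show "t \<in> F (Suc n) \<alpha>" unfolding F_def by blast
  qed
  have F_nonneg: "F n \<alpha> \<subseteq> {0..}" if "0 \<le> \<alpha>" for n \<alpha> using that by (auto simp: F_def)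
  have F_count: "countable (F n \<alpha>)" "countable (F0 n)" for n \<alpha> by (auto simp: F_def F0_def)
  have supF: "emeasure N (R u (grid \<alpha>)) = (SUP n. emeasure N (R u (F n \<alpha>)))" if "0 \<le> \<alpha>" for u \<alpha>
    unfolding gridF by (intro sup F_count F_nonneg[OF that] F_mono)
  have F0_eq: "F0 n = F n 0 \<inter> {0<..}" for n
  proof -
    have "(\<lambda>j. 1 / 2 ^ Suc n + real j * (1 / 2 ^ Suc n)) = (\<lambda>j. real j * (1 / 2 ^ Suc n)) \<circ> Suc"
      by (simp add: fun_eq_iff field_simps)
    then have "F0 n = (\<lambda>j. real j * (1 / 2 ^ Suc n)) ` (Suc ` {..2 ^ n - 1})" by (simp only: F0_def image_comp)
    also have "Suc ` {..2 ^ n - 1} = {1..2 ^ n}" by (simp add: image_Suc_atMost)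
    finally show ?thesis by (force simp: F_def Suc_le_eq)
  qed
  have sup0: "emeasure N (R u (grid 0 \<inter> {0<..})) = (SUP n. emeasure N (R u (F0 n)))" for u
  proof -
    have "grid 0 \<inter> {0<..} = (\<Union>n. F0 n)" by (auto simp: F0_eq gridF)
    then show ?thesis using F_mono[of _ 0] by (simp only:) (intro sup F_count; auto simp: F0_eq)
  qed
  have pe: "emeasure N (R u D) = ennreal (p u D)" for u D
    by (simp add: p_def R_def N.emeasure_eq_measure)
  obtain C K where "0 < C" and lower: "\<And>u. 0 < u \<Longrightarrow> ennreal (C * exp (- (q_const a \<rho> * u\<^sup>2 / 2) - K * u)) \<le> low u"
    using ruin_set_lower[OF \<rho>(2,3), of a c1 v2] unfolding low_def by blast
  show ?thesis
    using hit_probability_asymptotics[OF \<rho> x \<zeta>, of c1 v2, folded I_def low_def L_def]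
      inverse_square_small[OF half_gt_zero[OF zero_less_one], of x] eventually_gt_at_top[of 0]
  proof eventually_elim
    case (elim u)
    let ?\<delta> = "x / u\<^sup>2"
    let ?P1 = "emeasure N (R u (grid (1/2)))" and ?P2 = "emeasure N (R u (grid (1/2 - ?\<delta>)))"
    have half: "0 < 1 / 2 - ?\<delta>" using elim(2) by simp
    have h: "0 < (1 / 2 ^ Suc n :: real)" "real (2 ^ n) * (1 / 2 ^ Suc n) = 1 / 2"
      "1 / 2 ^ Suc n + real (2 ^ n - 1) * (1 / 2 ^ Suc n) = 1 / 2" for n :: nat
      by (auto simp: of_nat_diff field_simps)
    have "low u = emeasure N (R u {1})"
    proof -
      \<comment> \<open>Time 1 as a walk without steps; its step size 1 is a dummy.\<close>
      have "(\<lambda>j. 1 + real j * 1) ` {..0} = {1}" by auto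
      then have "emeasure N (R u {1}) = I u 0 1 1" using chain[of 1 1 u 0] by simp
      also have "\<dots> = low u" by (simp add: I_def low_def)
      finally show ?thesis ..
    qed
    also have "\<dots> \<le> ?P1"
    proof (rule emeasure_mono)
      have "1 \<in> F 0 (1/2)" unfolding F_def by (rule image_eqI[of _ _ 1]) auto
      then show "R u {1} \<subseteq> R u (grid (1/2))" by (auto simp: R_def gridF)
      show "R u (grid (1/2)) \<in> sets N" using grid_bounds by (intro Rm countable_grid) force
    qed
    finally have low1: "low u \<le> ?P1" .
    then have zlow: "ennreal \<zeta> * low u \<le> ennreal \<zeta> * ?P1" by (intro mult_left_mono) auto
    have I1: "I u (2 ^ n) (1 / 2 ^ Suc n) (1 / 2) = emeasure N (R u (F n (1/2)))" for n
      unfolding F_def by (rule chain[symmetric]) auto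
    have I2: "I u (2 ^ n) (1 / 2 ^ Suc n) (1 / 2 - ?\<delta>) = emeasure N (R u (F n (1/2 - ?\<delta>)))" for n
      unfolding F_def using half by (intro chain[symmetric]) auto
    have I0: "I u (2 ^ n - 1) (1 / 2 ^ Suc n) (1 / 2 ^ Suc n) = emeasure N (R u (F0 n))" for n
      unfolding F0_def by (rule chain[symmetric]) auto
    have le1: "emeasure N (R u (F n (1/2))) \<le> ?P1" for n
      unfolding supF[OF half_gt_zero[OF zero_less_one, THEN less_imp_le]] by (rule SUP_upper) simp
    have le2: "emeasure N (R u (F n (1/2 - ?\<delta>))) \<le> ?P2" for n
      unfolding supF[OF less_imp_le[OF half]] by (rule SUP_upper) simp
    have "ennreal (C * exp (- (q_const a \<rho> * u\<^sup>2 / 2) - K * u)) \<le> ?P1"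
      using lower[OF elim(3)] low1 by (rule order_trans)
    then have 1: "0 < p u (grid (1/2))"
      using \<open>0 < C\<close> unfolding pe by (subst (asm) ennreal_le_iff) (auto simp: p_def intro: less_le_trans[rotated])
    have "emeasure N (R u (grid 0 \<inter> {0<..})) \<le> ennreal \<zeta> * ?P1"
      unfolding sup0
    proof (rule SUP_least)
      fix n
      have "I u (2 ^ n - 1) (1 / 2 ^ Suc n) (1 / 2 ^ Suc n) \<le> ennreal \<zeta> * low u"
        using elim(1) h by blast
      then show "emeasure N (R u (F0 n)) \<le> ennreal \<zeta> * ?P1" unfolding I0 using zlow by (rule order_trans)
    qed
    then have 2: "p u (grid 0 \<inter> {0<..}) \<le> \<zeta> * p u (grid (1 / 2))"
      using \<zeta> unfolding pe by (subst (asm) ennreal_mult[symmetric]) (auto simp: p_def)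
    have "?P2 \<le> ennreal (L + \<zeta>) * ?P1 + ennreal \<zeta> * ?P1"
      unfolding supF[OF less_imp_le[OF half]]
    proof (rule SUP_least)
      fix n
      have "I u (2 ^ n) (1 / 2 ^ Suc n) (1 / 2 - ?\<delta>) \<le> ennreal (L + \<zeta>) * I u (2 ^ n) (1 / 2 ^ Suc n) (1 / 2) + ennreal \<zeta> * low u"
        using elim(1) h by blast
      also have "\<dots> \<le> ennreal (L + \<zeta>) * ?P1 + ennreal \<zeta> * ?P1"
        unfolding I1 by (intro add_mono mult_left_mono le1 zlow) auto
      finally show "emeasure N (R u (F n (1 / 2 - ?\<delta>))) \<le> ennreal (L + \<zeta>) * ?P1 + ennreal \<zeta> * ?P1" unfolding I2 .
    qed
    also have "\<dots> = ennreal ((L + 2 * \<zeta>) * p u (grid (1/2)))"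
      using \<zeta> unfolding pe L_def by (subst (1 2) ennreal_mult[symmetric], simp_all add: p_def flip: ennreal_plus) (simp add: algebra_simps)
    finally have 3: "p u (grid (1 / 2 - ?\<delta>)) \<le> (L + 2 * \<zeta>) * p u (grid (1 / 2))"
      using \<zeta> unfolding pe by (subst (asm) ennreal_le_iff) (auto simp: p_def L_def add_nonneg_nonneg)
    have "ennreal (L - \<zeta>) * ?P1 = (SUP n. ennreal (L - \<zeta>) * emeasure N (R u (F n (1/2))))"
      by (subst supF) (auto simp: SUP_mult_left_ennreal)
    also have "\<dots> \<le> ?P2 + ennreal \<zeta> * ?P1"
    proof (rule SUP_least)
      fix n
      have "ennreal (L - \<zeta>) * I u (2 ^ n) (1 / 2 ^ Suc n) (1 / 2) \<le> I u (2 ^ n) (1 / 2 ^ Suc n) (1 / 2 - ?\<delta>) + ennreal \<zeta> * low u"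
        using elim(1) h by blast
      also have "\<dots> \<le> ?P2 + ennreal \<zeta> * ?P1" unfolding I2 by (intro add_mono le2 zlow)
      finally show "ennreal (L - \<zeta>) * emeasure N (R u (F n (1/2))) \<le> ?P2 + ennreal \<zeta> * ?P1" unfolding I1 .
    qed
    also have "\<dots> = ennreal (p u (grid (1/2 - ?\<delta>)) + \<zeta> * p u (grid (1/2)))"
      using \<zeta> unfolding pe by (subst ennreal_mult[symmetric]) (auto simp: p_def simp flip: ennreal_plus)
    finally have lowineq: "ennreal (L - \<zeta>) * ?P1 \<le> ennreal (p u (grid (1/2 - ?\<delta>)) + \<zeta> * p u (grid (1/2)))" .
    \<comment> \<open>If \<open>L - \<zeta> \<le> 0\<close>, the factor in \<open>lowineq\<close> is
      truncated to 0 and carries no information, but then the claim is a sign comparison.\<close>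
    have 4: "(L - 2 * \<zeta>) * p u (grid (1 / 2)) \<le> p u (grid (1 / 2 - ?\<delta>))"
    proof (cases "L - \<zeta> \<le> 0")
      case True
      then have "(L - 2 * \<zeta>) * p u (grid (1 / 2)) \<le> 0" using \<zeta> by (intro mult_nonpos_nonneg) (auto simp: p_def)
      then show ?thesis by (rule order_trans) (simp add: p_def)
    next
      case False
      have "ennreal ((L - \<zeta>) * p u (grid (1/2))) \<le> ennreal (p u (grid (1/2 - ?\<delta>)) + \<zeta> * p u (grid (1/2)))"
        using lowineq False unfolding pe by (subst ennreal_mult) (auto simp: p_def)
      then have "(L - \<zeta>) * p u (grid (1/2)) \<le> p u (grid (1/2 - ?\<delta>)) + \<zeta> * p u (grid (1/2))"
        using \<zeta> by (subst (asm) ennreal_le_iff) (auto simp: p_def)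
      then show ?thesis by (simp add: algebra_simps)
    qed
    show ?case using 1 2 3 4 by simp
  qed
qed

text \<open>Along a continuous path the ruin times are relatively open, so a ruin time can be moved
  slightly: to a rational, to a grid point, or strictly earlier. The windows from 0 and from
  \<open>1 / 2 - \<delta>\<close> together cover \<open>{0..<1 - \<delta>}\<close>.\<close>

lemma continuous_ruin_iff_grid:
  fixes W1 W2 :: "real \<Rightarrow> 'a \<Rightarrow> real" and c1 c2 a u \<delta> :: real and \<omega> :: 'a
  assumes W: "continuous_on {0..} (\<lambda>t. W1 t \<omega>)" "continuous_on {0..} (\<lambda>t. W2 t \<omega>)"
    and \<delta>: "0 \<le> \<delta>" "\<delta> < 1 / 2"
  defines "S \<equiv> ruin_at W1 W2 c1 c2 a u \<omega>"
  shows "(\<exists>t\<in>{0..1}. S t) \<longleftrightarrow> (\<exists>t\<in>{0..1} \<inter> \<rat>. S t)"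
    and "(\<exists>t\<in>{0..<1 - \<delta>}. S t) \<longleftrightarrow> (\<exists>t\<in>{0..<1 - \<delta>} \<inter> \<rat>. S t)"
    and "(\<exists>t\<in>grid (1 / 2). S t) \<Longrightarrow> (\<exists>t\<in>{0..1}. S t)"
    and "(\<exists>t\<in>{0..1}. S t) \<Longrightarrow> (\<exists>t\<in>grid 0 \<inter> {0<..}. S t) \<or> (\<exists>t\<in>grid (1 / 2). S t)"
    and "(\<exists>t\<in>grid (1 / 2 - \<delta>). S t) \<Longrightarrow> (\<exists>t\<in>{0..<1 - \<delta>}. S t)"
    and "(\<exists>t\<in>{0..<1 - \<delta>}. S t) \<Longrightarrow> (\<exists>t\<in>grid 0 \<inter> {0<..}. S t) \<or> (\<exists>t\<in>grid (1 / 2 - \<delta>). S t)"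
proof -
  have op: "\<exists>e>0. \<forall>s\<ge>0. \<bar>s - t\<bar> < e \<longrightarrow> S s" if "0 \<le> t" "S t" for t
    using ruin_at_open[OF W that[unfolded S_def]] unfolding S_def by metis
  have rat: "\<exists>t\<in>{0..<b} \<inter> \<rat>. S t" if t: "t \<in> {0..<b}" "S t" for b t
  proof -
    obtain e where e: "0 < e" "\<And>s. 0 \<le> s \<Longrightarrow> \<bar>s - t\<bar> < e \<Longrightarrow> S s" using op[of t] t by auto
    have "t < min b (t + e)" using t e by auto
    then obtain r where r: "r \<in> \<rat>" "t < r" "r < min b (t + e)" using Rats_dense_in_real by blast
    then show ?thesis using t e(2)[of r] by (intro bexI[of _ r]) auto
  qed
  have gr: "\<exists>s\<in>grid \<alpha> \<inter> {\<alpha><..}. S s" if t: "\<alpha> \<le> t" "t \<le> \<alpha> + 1 / 2" "S t" "0 \<le> \<alpha>" for \<alpha> t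
  proof -
    obtain e where e: "0 < e" "\<And>s. 0 \<le> s \<Longrightarrow> \<bar>s - t\<bar> < e \<Longrightarrow> S s" using op[of t] t by auto
    obtain s where "s \<in> grid \<alpha>" "\<bar>s - t\<bar> < e" "\<alpha> < s" using grid_dense[OF t(1,2) e(1)] .
    then show ?thesis using e(2)[of s] t by (intro bexI[of _ s]) auto
  qed
  show "(\<exists>t\<in>{0..1}. S t) \<longleftrightarrow> (\<exists>t\<in>{0..1} \<inter> \<rat>. S t)"
  proof
    assume "\<exists>t\<in>{0..1}. S t"
    then obtain t where t: "t \<in> {0..1}" "S t" by auto
    show "\<exists>t\<in>{0..1} \<inter> \<rat>. S t"
    proof (cases "t = 1")
      case False
      then have "t \<in> {0..<1}" using t by auto
      from rat[OF this t(2)] show ?thesis by force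
    qed (use t in auto)
  qed auto
  show "(\<exists>t\<in>{0..<1 - \<delta>}. S t) \<longleftrightarrow> (\<exists>t\<in>{0..<1 - \<delta>} \<inter> \<rat>. S t)"
    using rat[of _ "1 - \<delta>"] by blast
  show "\<exists>t\<in>{0..1}. S t" if "\<exists>t\<in>grid (1 / 2). S t"
    using that grid_bounds[of _ "1/2"] by force
  show "(\<exists>t\<in>grid 0 \<inter> {0<..}. S t) \<or> (\<exists>t\<in>grid (1 / 2). S t)" if ex: "\<exists>t\<in>{0..1}. S t"
  proof -
    obtain t where t: "0 \<le> t" "t \<le> 1" "S t" using ex by auto
    show ?thesis
    proof (cases "t \<le> 1/2")
      case True then show ?thesis using gr[of 0 t] t by auto
    next
      case False then show ?thesis using gr[of "1/2" t] t by auto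
    qed
  qed
  \<comment> \<open>The grid contains its right end \<open>1 - \<delta>\<close>, which the interval
    excludes; openness provides an earlier ruin time.\<close>
  show "\<exists>t\<in>{0..<1 - \<delta>}. S t" if ex: "\<exists>t\<in>grid (1 / 2 - \<delta>). S t"
  proof -
    obtain t where t: "1 / 2 - \<delta> \<le> t" "t \<le> 1 - \<delta>" "S t"
      using ex grid_bounds[of _ "1/2 - \<delta>"] by force
    then obtain e where e: "0 < e" "\<And>s. 0 \<le> s \<Longrightarrow> \<bar>s - t\<bar> < e \<Longrightarrow> S s" using op[of t] \<delta> by auto
    define s where "s = max 0 (t - e / 2)"
    have "0 < 1 - \<delta>" using \<delta> by simp
    have "0 < t" using t \<delta> by linarith
    then have "0 \<le> s" "\<bar>s - t\<bar> < e" "s < 1 - \<delta>" using e t \<open>0 < 1 - \<delta>\<close> by (auto simp: s_def max_def)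
    then show ?thesis using e(2)[of s] by auto
  qed
  show "(\<exists>t\<in>grid 0 \<inter> {0<..}. S t) \<or> (\<exists>t\<in>grid (1 / 2 - \<delta>). S t)" if ex: "\<exists>t\<in>{0..<1 - \<delta>}. S t"
  proof -
    obtain t where t: "0 \<le> t" "t < 1 - \<delta>" "S t" using ex by auto
    show ?thesis
    proof (cases "t \<le> 1/2")
      case True then show ?thesis using gr[of 0 t] t by auto
    next
      case False then show ?thesis using gr[of "1/2 - \<delta>" t] t \<delta> by auto
    qed
  qed
qed

text \<open>In the application \<open>g1\<close> and \<open>g2\<close> belong to the two grids,
  \<open>g0\<close> to early ruin, \<open>p\<close> and \<open>p'\<close> to continuous time. The
  upper bound pays one more \<zeta> for \<open>g0\<close>; the lower one uses
  \<open>p \<le> (1 + \<zeta>) * g1\<close> and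
  \<open>(L - 4 * \<zeta>) * \<zeta> \<le> \<zeta>\<close>.\<close>

lemma ratio_sandwich:
  fixes g1 p g0 g2 p' \<zeta> L :: real
  assumes "g1 \<le> p" "p \<le> g0 + g1" "g2 \<le> p'" "p' \<le> g0 + g2"
    and g1: "0 < g1" and "g0 \<le> \<zeta> * g1" "g2 \<le> (L + 2 * \<zeta>) * g1" "(L - 2 * \<zeta>) * g1 \<le> g2"
    and "0 < \<zeta>" "0 < L" "L \<le> 1" and "0 \<le> g2"
  shows "\<bar>p' / p - L\<bar> \<le> 4 * \<zeta>" "0 < p"
proof -
  show p: "0 < p" using assms by linarith
  have "p' \<le> (L + 3 * \<zeta>) * g1" using assms by (simp add: algebra_simps)
  also have "\<dots> \<le> (L + 4 * \<zeta>) * p" using assms by (intro mult_mono) auto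
  finally have 1: "p' / p \<le> L + 4 * \<zeta>" using p by (simp add: pos_divide_le_eq)
  have "(L - 4 * \<zeta>) * p \<le> p'"
  proof (cases "L - 4 * \<zeta> \<le> 0")
    case True
    then have "(L - 4 * \<zeta>) * p \<le> 0" using p by (intro mult_nonpos_nonneg) auto
    then show ?thesis using assms by linarith
  next
    case False
    then have "(L - 4 * \<zeta>) * p \<le> (L - 4 * \<zeta>) * ((1 + \<zeta>) * g1)"
      using assms by (intro mult_left_mono) (auto simp: algebra_simps)
    also have "\<dots> = ((L - 4 * \<zeta>) + (L - 4 * \<zeta>) * \<zeta>) * g1" by (simp add: algebra_simps)
    also have "\<dots> \<le> ((L - 4 * \<zeta>) + 1 * \<zeta>) * g1"
      using assms by (intro mult_right_mono add_left_mono) auto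
    also have "\<dots> \<le> (L - 2 * \<zeta>) * g1" using assms by (intro mult_right_mono) auto
    finally show ?thesis using assms by linarith
  qed
  then have "L - 4 * \<zeta> \<le> p' / p" using p by (simp add: pos_le_divide_eq)
  with 1 show "\<bar>p' / p - L\<bar> \<le> 4 * \<zeta>" by linarith
qed

theorem theorem2p3:
  fixes M :: "'b measure" and B1 B2 :: "real \<Rightarrow> 'b \<Rightarrow> real"
    and N :: "'a measure" and W1 W2 :: "real \<Rightarrow> 'a \<Rightarrow> real"
    and c1 c2 a \<rho> x :: real
  assumes "standard_brownian_motion M B1" and "standard_brownian_motion M B2"
    and "independent_processes M B1 B2"
    and "prob_space N" and "continuous_process N W1" and "continuous_process N W2"
    and "process_law N (\<lambda>t \<omega>. (W1 t \<omega>, W2 t \<omega>)) =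
         process_law M (\<lambda>t \<omega>. (B1 t \<omega>, \<rho> * B1 t \<omega> + sqrt (1 - \<rho>\<^sup>2) * B2 t \<omega>))"
    and "a \<le> 1" and "-1 < \<rho>" and "\<rho> < 1" and "0 \<le> x"
  shows "((\<lambda>u. cond_prob (completion N)
             (\<lambda>\<omega>. ereal (u\<^sup>2) * (1 - tau_sim W1 W2 c1 c2 a u \<omega>) \<le> ereal x)
             (\<lambda>\<omega>. tau_sim W1 W2 c1 c2 a u \<omega> \<le> 1))
          \<longlongrightarrow> 1 - exp (- (q_const a \<rho> * x / 2))) at_top"
proof (rule tendstoI)
  fix \<epsilon> :: real assume "0 < \<epsilon>"
  \<comment> \<open>\<open>ratio_sandwich\<close> loses \<open>4 * \<zeta>\<close>; a fifth of
    \<epsilon> keeps the final inequality strict.\<close>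
  define \<zeta> where "\<zeta> = \<epsilon> / 5"
  have \<zeta>: "0 < \<zeta>" using \<open>0 < \<epsilon>\<close> by (simp add: \<zeta>_def)
  define L where "L = exp (- (q_const a \<rho> * x / 2))"
  have L: "0 < L" "L \<le> 1"
    using \<open>0 \<le> x\<close> q_const_ge_1[of \<rho> a] assms by (auto simp: L_def)
  interpret prob_space N by fact
  have Wm: "\<And>t. 0 \<le> t \<Longrightarrow> W1 t \<in> borel_measurable N" "\<And>t. 0 \<le> t \<Longrightarrow> W2 t \<in> borel_measurable N"
    using assms by (auto simp: continuous_process_def)
  have cont: "AE \<omega> in N. continuous_on {0..} (\<lambda>t. W1 t \<omega>)" "AE \<omega> in N. continuous_on {0..} (\<lambda>t. W2 t \<omega>)"
    using assms by (auto simp: continuous_process_def)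
  show "\<forall>\<^sub>F u in at_top. dist (cond_prob (completion N)
             (\<lambda>\<omega>. ereal (u\<^sup>2) * (1 - tau_sim W1 W2 c1 c2 a u \<omega>) \<le> ereal x)
             (\<lambda>\<omega>. tau_sim W1 W2 c1 c2 a u \<omega> \<le> 1)) (1 - exp (- (q_const a \<rho> * x / 2))) < \<epsilon>"
    using grid_ruin_asymptotics[OF assms \<zeta>, of c1 c2, folded L_def]
      inverse_square_small[OF half_gt_zero[OF zero_less_one], of x] eventually_gt_at_top[of 0]
  proof eventually_elim
    case (elim u)
    let ?\<delta> = "x / u\<^sup>2"
    have \<delta>: "0 \<le> ?\<delta>" "?\<delta> < 1 / 2" using elim \<open>0 \<le> x\<close> by auto
    define A where "A D = {\<omega> \<in> space N. \<exists>t\<in>D. ruin_at W1 W2 c1 c2 a u \<omega> t}" for D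
    let ?Q = "A {0..1}" and ?Q' = "A {0..<1 - ?\<delta>}"
    let ?G0 = "A (grid 0 \<inter> {0<..})" and ?G1 = "A (grid (1/2))" and ?G2 = "A (grid (1/2 - ?\<delta>))"
    have Am: "A D \<in> sets N" if "countable D" "D \<subseteq> {0..}" for D
      unfolding A_def by (rule ruin_measurable[OF Wm that])
    have cR: "countable (X \<inter> \<rat>)" for X :: "real set" using countable_rat by (rule countable_subset[rotated]) auto
    have Gm: "?G0 \<in> sets N" "?G1 \<in> sets N" "?G2 \<in> sets N"
      using grid_bounds[of _ "1/2"] grid_bounds[of _ "1/2 - ?\<delta>"] \<delta>
      by (force intro!: Am countable_grid countable_Int1)+
    have Rm: "A ({0..1} \<inter> \<rat>) \<in> sets N" "A ({0..<1 - ?\<delta>} \<inter> \<rat>) \<in> sets N"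
      by (auto intro!: Am cR)
    \<comment> \<open>The rational versions provide measurable events for the completion, the grid
      versions the numerical bounds; all hold off one null set.\<close>
    have ae: "AE \<omega> in N. (\<omega> \<in> ?Q \<longleftrightarrow> \<omega> \<in> A ({0..1} \<inter> \<rat>)) \<and> (\<omega> \<in> ?Q' \<longleftrightarrow> \<omega> \<in> A ({0..<1 - ?\<delta>} \<inter> \<rat>)) \<and>
        (\<omega> \<in> ?G1 \<longrightarrow> \<omega> \<in> ?Q) \<and> (\<omega> \<in> ?Q \<longrightarrow> \<omega> \<in> ?G0 \<union> ?G1) \<and>
        (\<omega> \<in> ?G2 \<longrightarrow> \<omega> \<in> ?Q') \<and> (\<omega> \<in> ?Q' \<longrightarrow> \<omega> \<in> ?G0 \<union> ?G2)"
      using cont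
    proof eventually_elim
      fix \<omega> assume "continuous_on {0..} (\<lambda>t. W1 t \<omega>)" "continuous_on {0..} (\<lambda>t. W2 t \<omega>)"
      note c = continuous_ruin_iff_grid[of W1 \<omega> W2 ?\<delta> c1 c2 a u, OF this \<delta>]
      show "(\<omega> \<in> ?Q \<longleftrightarrow> \<omega> \<in> A ({0..1} \<inter> \<rat>)) \<and> (\<omega> \<in> ?Q' \<longleftrightarrow> \<omega> \<in> A ({0..<1 - ?\<delta>} \<inter> \<rat>)) \<and>
        (\<omega> \<in> ?G1 \<longrightarrow> \<omega> \<in> ?Q) \<and> (\<omega> \<in> ?Q \<longrightarrow> \<omega> \<in> ?G0 \<union> ?G1) \<and>
        (\<omega> \<in> ?G2 \<longrightarrow> \<omega> \<in> ?Q') \<and> (\<omega> \<in> ?Q' \<longrightarrow> \<omega> \<in> ?G0 \<union> ?G2)"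
        unfolding A_def Un_iff mem_Collect_eq using c by blast
    qed
    then have aeQ: "AE \<omega> in N. \<omega> \<in> ?Q \<longleftrightarrow> \<omega> \<in> A ({0..1} \<inter> \<rat>)"
      and aeQ': "AE \<omega> in N. \<omega> \<in> ?Q' \<longleftrightarrow> \<omega> \<in> A ({0..<1 - ?\<delta>} \<inter> \<rat>)"
      by (rule AE_mp, intro AE_I2, blast)+
    note Q = measure_completion_AE_eq[OF Rm(1) _ aeQ] and Q' = measure_completion_AE_eq[OF Rm(2) _ aeQ']
    have Qm: "?Q \<in> sets (completion N)" "?Q' \<in> sets (completion N)"
      using Q(1) Q'(1) by (auto simp: A_def)
    let ?P = "measure (completion N) ?Q" and ?P' = "measure (completion N) ?Q'"
    have P: "?P = prob (A ({0..1} \<inter> \<rat>))" "?P' = prob (A ({0..<1 - ?\<delta>} \<inter> \<rat>))"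
      using Q(2) Q'(2) by (auto simp: A_def)
    have sub: "?Q' \<subseteq> ?Q" using \<delta> by (force simp: A_def)
    have "prob ?G1 \<le> ?P"
      unfolding P by (rule finite_measure_mono_AE[OF _ Rm(1)]) (use ae in \<open>eventually_elim, blast\<close>)
    moreover have "?P \<le> prob ?G0 + prob ?G1"
    proof -
      have "?P \<le> prob (?G0 \<union> ?G1)"
        unfolding P by (rule finite_measure_mono_AE[OF _ sets.Un[OF Gm(1,2)]]) (use ae in \<open>eventually_elim, blast\<close>)
      also have "\<dots> \<le> prob ?G0 + prob ?G1" by (rule measure_Un_le[OF Gm(1,2)])
      finally show ?thesis .
    qed
    moreover have "prob ?G2 \<le> ?P'"
      unfolding P by (rule finite_measure_mono_AE[OF _ Rm(2)]) (use ae in \<open>eventually_elim, blast\<close>)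
    moreover have "?P' \<le> prob ?G0 + prob ?G2"
    proof -
      have "?P' \<le> prob (?G0 \<union> ?G2)"
        unfolding P by (rule finite_measure_mono_AE[OF _ sets.Un[OF Gm(1,3)]]) (use ae in \<open>eventually_elim, blast\<close>)
      also have "\<dots> \<le> prob ?G0 + prob ?G2" by (rule measure_Un_le[OF Gm(1,3)])
      finally show ?thesis .
    qed
    moreover have "0 < prob ?G1" "prob ?G0 \<le> \<zeta> * prob ?G1" "prob ?G2 \<le> (L + 2 * \<zeta>) * prob ?G1"
       "(L - 2 * \<zeta>) * prob ?G1 \<le> prob ?G2"
      using elim(1) by (auto simp: A_def)
    ultimately have r: "\<bar>?P' / ?P - L\<bar> \<le> 4 * \<zeta>" and "0 < ?P"
      using ratio_sandwich[of "prob ?G1" ?P "prob ?G0" "prob ?G2" ?P' \<zeta> L] \<zeta> L by auto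
    have "4 * \<zeta> < \<epsilon>" using \<open>0 < \<epsilon>\<close> by (simp add: \<zeta>_def)
    with r have "\<bar>?P' / ?P - L\<bar> < \<epsilon>" by linarith
    \<comment> \<open>Late ruin is ruin on \<open>[0, 1]\<close> without ruin before
      \<open>1 - ?\<delta>\<close>, so the conditional probability is complementary to the ratio
      just estimated.\<close>
    moreover have "cond_prob (completion N)
             (\<lambda>\<omega>. ereal (u\<^sup>2) * (1 - tau_sim W1 W2 c1 c2 a u \<omega>) \<le> ereal x)
             (\<lambda>\<omega>. tau_sim W1 W2 c1 c2 a u \<omega> \<le> 1) = 1 - ?P' / ?P"
    proof -
      have "{\<omega> \<in> space (completion N). ereal (u\<^sup>2) * (1 - tau_sim W1 W2 c1 c2 a u \<omega>) \<le> ereal x \<and> tau_sim W1 W2 c1 c2 a u \<omega> \<le> 1} = ?Q - ?Q'"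
        unfolding tau_sim_late_iff[OF elim(3) \<open>0 \<le> x\<close>] by (auto simp: A_def)
      moreover have "{\<omega> \<in> space (completion N). tau_sim W1 W2 c1 c2 a u \<omega> \<le> 1} = ?Q"
        unfolding tau_sim_le_1_iff by (auto simp: A_def)
      moreover have "measure (completion N) (?Q - ?Q') = ?P - ?P'"
        using sub Qm by (intro measure_Diff) (auto simp: P emeasure_eq_measure)
      ultimately show ?thesis
        using \<open>0 < ?P\<close> by (simp add: cond_prob_def diff_divide_distrib)
    qed
    ultimately show ?case by (simp add: dist_real_def L_def abs_minus_commute)
  qed
qed

end
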